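(* Let $(M,g,\Phi)$ be an $8$-dimensional Riemannian manifold with a ${\rm Spin}(7)$-structure, with intrinsic torsion $\xi$ and Lee form $\theta$. Then for every vector field $X$ on $M$, $\xi_X$ (regarded as a $2$-form) can be described in the following two ways: $$\xi_X=-\frac{1}{2}(X\lrcorner\delta\Phi)_7+\frac{7}{4}(X^{\flat}\wedge\theta)_7$$ and $$\xi_X=-\frac{1}{2}(X\lrcorner(\delta\Phi)_{48})_7+\frac{1}{4}(X^{\flat}\wedge\theta)_7.$$
   Context: A ${\rm Spin}(7)$-structure on an $8$-dimensional Riemannian manifold $(M,g)$ is a global $4$-form $\Phi$ such that around each point there is a local orthonormal frame $e_0,\dots,e_7$ with dual coframe $e^0,\dots,e^7$ in which (writing $e^{ijkl}=e^i\wedge e^j\wedge e^k\wedge e^l$) $$\Phi=e^{0123}-e^{0145}-e^{0167}-e^{0246}+e^{0257}-e^{0347}-e^{0356}+e^{4567}-e^{2367}-e^{2345}-e^{1357}+e^{1346}-e^{1256}-e^{1247}.$$ $M$ is oriented by $e^{01234567}$, $\star$ is the Hodge star, $\star\Phi=\Phi$, and $\delta\Phi=-\star d\star\Phi$ is the codifferential. ${\rm Spin}(7)\subset SO(8)$ is the stabilizer of $\Phi$. Pointwise ${\rm Spin}(7)$-decompositions: $\Lambda^2=\Lambda^2_7\oplus\Lambda^2_{21}$ with $\Lambda^2_7=\{\omega:\star(\Phi\wedge\omega)=3\omega\}$ and $\Lambda^2_{21}=\{\omega:\star(\Phi\wedge\omega)=-\omega\}$; $\Lambda^3=\Lambda^3_8\oplus\Lambda^3_{48}$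 with $\Lambda^3_8=\{\star(\Phi\wedge\eta):\eta\in\Lambda^1\}$ and $\Lambda^3_{48}=\{\gamma:\Phi\wedge\gamma=0\}$. Subscripts on a form denote its components; in particular $\omega_7=\frac14(\omega+\star(\Phi\wedge\omega))$ for a $2$-form $\omega$. Lee form: $\theta=\frac{1}{7}\star(\delta\Phi\wedge\Phi)$. Skew endomorphisms $A$ of $TM$ are identified with $2$-forms via $(Y,Z)\mapsto g(AY,Z)$; with this identification $\mathfrak{so}(8)=\mathfrak{spin}(7)\oplus\mathfrak{spin}(7)^{\perp}$ corresponds to $\Lambda^2=\Lambda^2_{21}\oplus\Lambda^2_7$. Wedge convention: $(\alpha\wedge\beta)(Y,Z)=\alpha(Y)\beta(Z)-\alpha(Z)\beta(Y)$ for $1$-forms; $X\lrcorner$ denotes contraction in the first slot, and $X^\flat=g(X,\cdot)$. Let $\nabla$ be the Levi-Civita connection. The minimal ${\rm Spin}(7)$-connection $\nabla^{{\rm Spin}(7)}$ is the connection given by the $\mathfrak{spin}(7)$-component of the Levi-Civita connection form; the intrinsic torsion is the $(1,2)$-tensor $\xi=\nabla^{{\rm Spin}(7)}-\nabla$. Equivalently, $\nabla^{{\rm Spin}(7)}=\nabla+\xi$ is the unique metric connection with $\nabla^{{\rm Spin}(7)}\Phi=0$ and $\xi_X\in\Lambda^2_7$ for all $X$. *)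

theory Defs
  imports "HOL-Analysis.Analysis"
begin

section \<open>Smooth manifolds of dimension 8\<close>

text \<open>Smoothness on an open set: all iterated directional derivatives exist and are continuous.\<close>

primrec Ck_on :: "nat \<Rightarrow> (real^8) set \<Rightarrow> (real^8 \<Rightarrow> 'b::real_normed_vector) \<Rightarrow> bool" where
  "Ck_on 0 S f \<longleftrightarrow> continuous_on S f"
| "Ck_on (Suc k) S f \<longleftrightarrow>
     (\<forall>x\<in>S. f differentiable (at x)) \<and> (\<forall>v. Ck_on k S (\<lambda>x. frechet_derivative f (at x) v))"

definition smooth_on :: "(real^8) set \<Rightarrow> (real^8 \<Rightarrow> 'b::real_normed_vector) \<Rightarrow> bool" where
  "smooth_on S f \<longleftrightarrow> (\<forall>k. Ck_on k S f)"

text \<open>A chart is a pair of its domain and its coordinate map; the values of the map outside the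
  domain are irrelevant.\<close>

type_synonym 'a chart = "'a set \<times> ('a \<Rightarrow> real^8)"

definition chart_image :: "'a chart \<Rightarrow> (real^8) set" where
  "chart_image c = snd c ` fst c"

definition transition :: "'a chart \<Rightarrow> 'a chart \<Rightarrow> real^8 \<Rightarrow> real^8" where
  "transition c c' = snd c' \<circ> inv_into (fst c) (snd c)"

definition overlap :: "'a chart \<Rightarrow> 'a chart \<Rightarrow> (real^8) set" where
  "overlap c c' = snd c ` (fst c \<inter> fst c')"

definition smooth_manifold8 :: "'a topology \<Rightarrow> 'a chart set \<Rightarrow> bool" where
  "smooth_manifold8 M \<A> \<longleftrightarrow>
     Hausdorff_space M \<and> second_countable M \<and>
     (\<forall>c\<in>\<A>. openin M (fst c) \<and> open (chart_image c) \<and>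
        homeomorphic_map (subtopology M (fst c)) (top_of_set (chart_image c)) (snd c)) \<and>
     \<Union> (fst ` \<A>) = topspace M \<and>
     (\<forall>c\<in>\<A>. \<forall>c'\<in>\<A>. smooth_on (overlap c c') (transition c c'))"

text \<open>Tensor fields are given by their coordinate representations, one for each chart of the
  atlas, which are related by the differentials of the transition maps.\<close>

type_synonym 'a vector_field = "'a chart \<Rightarrow> real^8 \<Rightarrow> real^8"

definition vector_field :: "'a chart set \<Rightarrow> 'a vector_field \<Rightarrow> bool" where
  "vector_field \<A> X \<longleftrightarrow>
     (\<forall>c\<in>\<A>. smooth_on (chart_image c) (X c)) \<and>
     (\<forall>c\<in>\<A>. \<forall>c'\<in>\<A>. \<forall>x\<in>overlap c c'.
        X c' (transition c c' x) = frechet_derivative (transition c c') (at x) (X c x))"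

type_synonym scalar_product = "real^8 \<Rightarrow> real^8 \<Rightarrow> real"

definition riemannian_metric :: "'a chart set \<Rightarrow> ('a chart \<Rightarrow> real^8 \<Rightarrow> scalar_product) \<Rightarrow> bool" where
  "riemannian_metric \<A> g \<longleftrightarrow>
     (\<forall>c\<in>\<A>. \<forall>x\<in>chart_image c.
        bilinear (g c x) \<and> (\<forall>u v. g c x u v = g c x v u) \<and> (\<forall>v. v \<noteq> 0 \<longrightarrow> g c x v v > 0)) \<and>
     (\<forall>c\<in>\<A>. \<forall>u v. smooth_on (chart_image c) (\<lambda>x. g c x u v)) \<and>
     (\<forall>c\<in>\<A>. \<forall>c'\<in>\<A>. \<forall>x\<in>overlap c c'. \<forall>u v.
        g c x u v = g c' (transition c c' x)
          (frechet_derivative (transition c c') (at x) u)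
          (frechet_derivative (transition c c') (at x) v))"


section \<open>Exterior algebra\<close>

text \<open>A \<open>k\<close>-form on the model space is an alternating multilinear function of \<open>k\<close> vectors,
  represented as a function on lists that vanishes on the lists of any other length. Hence the
  operations below need no degree arguments.\<close>

type_synonym form = "(real^8) list \<Rightarrow> real"

definition forms :: "nat \<Rightarrow> form set" where
  "forms k = {\<omega>.
     (\<forall>vs. length vs \<noteq> k \<longrightarrow> \<omega> vs = 0) \<and>
     (\<forall>us ws. length us + length ws + 1 = k \<longrightarrow> linear (\<lambda>v. \<omega> (us @ v # ws))) \<and>
     (\<forall>vs. \<not> distinct vs \<longrightarrow> \<omega> vs = 0)}"

text \<open>The wedge product as a sum over shuffles: \<open>S\<close> is the set of positions of the arguments
  passed to the first factor, and the exponent counts the inversions of the shuffle. For 1-forms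
  this is \<open>\<alpha>(Y)\<beta>(Z) - \<alpha>(Z)\<beta>(Y)\<close>.\<close>

definition wedge :: "form \<Rightarrow> form \<Rightarrow> form" where
  "wedge \<alpha> \<beta> = (\<lambda>vs. \<Sum>S\<in>Pow {..<length vs}.
     (-1) ^ card {(i, j). i \<in> S \<and> j \<in> {..<length vs} - S \<and> j < i} * \<alpha> (nths vs S) * \<beta> (nths vs (- S)))"

definition contract :: "real^8 \<Rightarrow> form \<Rightarrow> form" where
  "contract X \<omega> = (\<lambda>vs. \<omega> (X # vs))"

definition flat :: "scalar_product \<Rightarrow> real^8 \<Rightarrow> form" where
  "flat G X = (\<lambda>vs. case vs of [Y] \<Rightarrow> G X Y | _ \<Rightarrow> 0)"

text \<open>The 2-form \<open>(Y,Z) \<mapsto> g(AY,Z)\<close> identified with an endomorphism \<open>A\<close>.\<close>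

definition endo_form :: "scalar_product \<Rightarrow> (real^8 \<Rightarrow> real^8) \<Rightarrow> form" where
  "endo_form G A = (\<lambda>vs. case vs of [Y, Z] \<Rightarrow> G (A Y) Z | _ \<Rightarrow> 0)"

text \<open>A frame is \<open>e 0, \<dots>, e 7\<close>; the other values of \<open>e\<close> are irrelevant. For an orthonormal frame
  the dual coframe is \<open>e\<^sup>i = g(e\<^sub>i, \<cdot>)\<close>.\<close>

definition orthonormal_frame :: "scalar_product \<Rightarrow> (nat \<Rightarrow> real^8) \<Rightarrow> bool" where
  "orthonormal_frame G e \<longleftrightarrow> (\<forall>i<8. \<forall>j<8. G (e i) (e j) = (if i = j then 1 else 0))"

primrec coframe_wedge :: "scalar_product \<Rightarrow> (nat \<Rightarrow> real^8) \<Rightarrow> nat list \<Rightarrow> form" where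
  "coframe_wedge G e [] = (\<lambda>vs. if vs = [] then 1 else 0)"
| "coframe_wedge G e (i # is) = wedge (flat G (e i)) (coframe_wedge G e is)"


section \<open>Spin(7)-structures: pointwise\<close>

definition spin7_form :: "scalar_product \<Rightarrow> (nat \<Rightarrow> real^8) \<Rightarrow> form" where
  "spin7_form G e = (\<lambda>vs. let E = (\<lambda>I. coframe_wedge G e I vs) in
     E [0,1,2,3] - E [0,1,4,5] - E [0,1,6,7] - E [0,2,4,6] + E [0,2,5,7] - E [0,3,4,7] - E [0,3,5,6]
     + E [4,5,6,7] - E [2,3,6,7] - E [2,3,4,5] - E [1,3,5,7] + E [1,3,4,6] - E [1,2,5,6] - E [1,2,4,7])"

definition spin7_frame :: "scalar_product \<Rightarrow> form \<Rightarrow> (nat \<Rightarrow> real^8) \<Rightarrow> bool" where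
  "spin7_frame G \<phi> e \<longleftrightarrow> orthonormal_frame G e \<and> \<phi> = spin7_form G e"

text \<open>Hodge star expressed in an orthonormal frame, for the orientation \<open>e\<^sup>0\<^sup>1\<^sup>2\<^sup>3\<^sup>4\<^sup>5\<^sup>6\<^sup>7\<close>:
  it maps \<open>e\<^sup>I\<close>, \<open>I\<close> increasing, to \<open>vol(e\<^sub>I, \<cdot>)\<close>, so that \<open>\<alpha> \<and> \<star>\<beta> = g(\<alpha>,\<beta>) vol\<close>
  for forms \<open>\<alpha>\<close>, \<open>\<beta>\<close> of equal degree.\<close>

definition frame_hodge :: "scalar_product \<Rightarrow> (nat \<Rightarrow> real^8) \<Rightarrow> form \<Rightarrow> form" where
  "frame_hodge G e \<omega> = (\<lambda>vs. \<Sum>I\<in>Pow {..<8}.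
     \<omega> (map e (sorted_list_of_set I)) *
     coframe_wedge G e [0..<8] (map e (sorted_list_of_set I) @ vs))"

text \<open>The Hodge star for the orientation induced by the Spin(7)-form \<open>\<phi>\<close>. It does not depend on
  the chosen frame: any two frames adapted to \<open>\<phi>\<close> are related by an element of Spin(7), hence of
  \<open>SO(8)\<close>.\<close>

definition hodge :: "scalar_product \<Rightarrow> form \<Rightarrow> form \<Rightarrow> form" where
  "hodge G \<phi> = frame_hodge G (SOME e. spin7_frame G \<phi> e)"

definition proj7 :: "scalar_product \<Rightarrow> form \<Rightarrow> form \<Rightarrow> form" where
  "proj7 G \<phi> \<omega> = (\<lambda>vs. 1/4 * (\<omega> vs + hodge G \<phi> (wedge \<phi> \<omega>) vs))"

definition proj21 :: "scalar_product \<Rightarrow> form \<Rightarrow> form \<Rightarrow> form" where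
  "proj21 G \<phi> \<omega> = (\<lambda>vs. \<omega> vs - proj7 G \<phi> \<omega> vs)"

definition Lambda3_8 :: "scalar_product \<Rightarrow> form \<Rightarrow> form set" where
  "Lambda3_8 G \<phi> = {hodge G \<phi> (wedge \<phi> \<eta>) | \<eta>. \<eta> \<in> forms 1}"

definition Lambda3_48 :: "form \<Rightarrow> form set" where
  "Lambda3_48 \<phi> = {\<gamma> \<in> forms 3. wedge \<phi> \<gamma> = (\<lambda>_. 0)}"

definition proj48 :: "scalar_product \<Rightarrow> form \<Rightarrow> form \<Rightarrow> form" where
  "proj48 G \<phi> \<gamma> = (THE \<gamma>'. \<gamma>' \<in> Lambda3_48 \<phi> \<and> (\<lambda>vs. \<gamma> vs - \<gamma>' vs) \<in> Lambda3_8 G \<phi>)"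


section \<open>Spin(7)-structures on manifolds\<close>

definition form_field :: "'a chart set \<Rightarrow> nat \<Rightarrow> ('a chart \<Rightarrow> real^8 \<Rightarrow> form) \<Rightarrow> bool" where
  "form_field \<A> k \<omega> \<longleftrightarrow>
     (\<forall>c\<in>\<A>. \<forall>x\<in>chart_image c. \<omega> c x \<in> forms k) \<and>
     (\<forall>c\<in>\<A>. \<forall>vs. smooth_on (chart_image c) (\<lambda>x. \<omega> c x vs)) \<and>
     (\<forall>c\<in>\<A>. \<forall>c'\<in>\<A>. \<forall>x\<in>overlap c c'. \<forall>vs.
        \<omega> c x vs = \<omega> c' (transition c c' x)
          (map (frechet_derivative (transition c c') (at x)) vs))"

text \<open>From here on, the arguments \<open>g\<close> and \<open>\<phi>\<close> of the local operators are the coordinate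
  representations of the metric and of the Spin(7)-form in one chart.\<close>

definition local_spin7_frame ::
    "(real^8) set \<Rightarrow> (real^8 \<Rightarrow> scalar_product) \<Rightarrow> (real^8 \<Rightarrow> form) \<Rightarrow> (real^8 \<Rightarrow> nat \<Rightarrow> real^8) \<Rightarrow> bool" where
  "local_spin7_frame N g \<phi> e \<longleftrightarrow>
     (\<forall>i<8. smooth_on N (\<lambda>y. e y i)) \<and> (\<forall>y\<in>N. spin7_frame (g y) (\<phi> y) (e y))"

definition spin7_structure ::
    "'a chart set \<Rightarrow> ('a chart \<Rightarrow> real^8 \<Rightarrow> scalar_product) \<Rightarrow> ('a chart \<Rightarrow> real^8 \<Rightarrow> form) \<Rightarrow> bool" where
  "spin7_structure \<A> g \<Phi> \<longleftrightarrow>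
     form_field \<A> 4 \<Phi> \<and>
     (\<forall>c\<in>\<A>. \<forall>x\<in>chart_image c. \<exists>N e. open N \<and> x \<in> N \<and> N \<subseteq> chart_image c \<and>
        local_spin7_frame N (g c) (\<Phi> c) e)"

text \<open>The invariant formula for the exterior derivative, evaluated on constant vector fields.\<close>

definition ext_deriv :: "(real^8 \<Rightarrow> form) \<Rightarrow> real^8 \<Rightarrow> form" where
  "ext_deriv \<omega> x = (\<lambda>vs. \<Sum>i<length vs. (-1) ^ i *
     frechet_derivative (\<lambda>y. \<omega> y (take i vs @ drop (Suc i) vs)) (at x) (vs ! i))"

definition codiff :: "(real^8 \<Rightarrow> scalar_product) \<Rightarrow> (real^8 \<Rightarrow> form) \<Rightarrow> (real^8 \<Rightarrow> form) \<Rightarrow> real^8 \<Rightarrow> form" where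
  "codiff g \<phi> \<omega> x =
     (\<lambda>vs. - hodge (g x) (\<phi> x) (ext_deriv (\<lambda>y. hodge (g y) (\<phi> y) (\<omega> y)) x) vs)"

definition lee_form :: "(real^8 \<Rightarrow> scalar_product) \<Rightarrow> (real^8 \<Rightarrow> form) \<Rightarrow> real^8 \<Rightarrow> form" where
  "lee_form g \<phi> x = (\<lambda>vs. 1/7 * hodge (g x) (\<phi> x) (wedge (codiff g \<phi> \<phi> x) (\<phi> x)) vs)"

text \<open>Christoffel symbols \<open>\<Gamma>(u,v) = \<nabla>\<^sub>u v\<close> (\<open>u\<close>, \<open>v\<close> constant in the chart) of the unique torsion-free
  metric connection.\<close>

definition christoffel :: "(real^8 \<Rightarrow> scalar_product) \<Rightarrow> real^8 \<Rightarrow> real^8 \<Rightarrow> real^8 \<Rightarrow> real^8" where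
  "christoffel g x = (THE \<Gamma>.
     (\<forall>u v. \<Gamma> u v = \<Gamma> v u) \<and>
     (\<forall>u v w. frechet_derivative (\<lambda>y. g y v w) (at x) u = g x (\<Gamma> u v) w + g x v (\<Gamma> u w)))"

definition levi_civita :: "(real^8 \<Rightarrow> scalar_product) \<Rightarrow> real^8 \<Rightarrow> real^8 \<Rightarrow> (real^8 \<Rightarrow> real^8) \<Rightarrow> real^8" where
  "levi_civita g x u Y = frechet_derivative Y (at x) u + christoffel g x u (Y x)"

text \<open>The Levi-Civita connection form in the orthonormal frame \<open>e\<close>, as an so(8)-valued 1-form:
  the value on \<open>u\<close> is the endomorphism with \<open>e\<^sub>i \<mapsto> \<nabla>\<^sub>u e\<^sub>i\<close>, regarded as a 2-form.\<close>

definition connection_form ::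
    "(real^8 \<Rightarrow> scalar_product) \<Rightarrow> (real^8 \<Rightarrow> nat \<Rightarrow> real^8) \<Rightarrow> real^8 \<Rightarrow> real^8 \<Rightarrow> form" where
  "connection_form g e x u =
     endo_form (g x) (\<lambda>Y. \<Sum>i<8. g x Y (e x i) *\<^sub>R levi_civita g x u (\<lambda>y. e y i))"

text \<open>The minimal connection replaces the connection form by its spin(7)-component, that is
  \<open>\<nabla>\<^sub>u (\<Sum>\<^sub>i Y\<^sup>i e\<^sub>i) = \<Sum>\<^sub>i (dY\<^sup>i(u) e\<^sub>i + Y\<^sup>i A e\<^sub>i)\<close> with \<open>A\<close> the endomorphism identified with that
  component. The choice of the adapted local frame does not matter, since changes of adapted frames
  take values in Spin(7).\<close>

definition minimal_connection ::
    "(real^8 \<Rightarrow> scalar_product) \<Rightarrow> (real^8 \<Rightarrow> form) \<Rightarrow> real^8 \<Rightarrow> real^8 \<Rightarrow> (real^8 \<Rightarrow> real^8) \<Rightarrow> real^8" where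
  "minimal_connection g \<phi> x u Y =
    (let e = (SOME e. \<exists>N. open N \<and> x \<in> N \<and> local_spin7_frame N g \<phi> e);
         \<omega> = proj21 (g x) (\<phi> x) (connection_form g e x u)
     in \<Sum>i<8. frechet_derivative (\<lambda>y. g y (Y y) (e y i)) (at x) u *\<^sub>R e x i
              + g x (Y x) (e x i) *\<^sub>R (\<Sum>j<8. \<omega> [e x i, e x j] *\<^sub>R e x j))"

text \<open>As a difference of connections the intrinsic torsion is tensorial, so the vector \<open>v\<close> may be
  extended to a constant vector field.\<close>

definition intrinsic_torsion ::
    "(real^8 \<Rightarrow> scalar_product) \<Rightarrow> (real^8 \<Rightarrow> form) \<Rightarrow> real^8 \<Rightarrow> real^8 \<Rightarrow> real^8 \<Rightarrow> real^8" where
  "intrinsic_torsion g \<phi> x u v =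
     minimal_connection g \<phi> x u (\<lambda>_. v) - levi_civita g x u (\<lambda>_. v)"

end

theory Submission
  imports Defs
begin

text \<open>At a point \<open>x\<close> let \<open>B\<^sub>u\<close> be the Levi-Civita connection form in an adapted local frame, evaluated on \<open>u\<close>.
  Then \<open>\<xi>\<^sub>u = - (B\<^sub>u)\<^sub>7\<close>, and since the coefficients of \<open>\<Phi>\<close> in the frame are constant, \<open>\<nabla>\<^sub>u\<Phi>\<close> is minus the
  action of \<open>B\<^sub>u\<close> on \<open>\<Phi>\<close>. As \<open>\<star>\<Phi> = \<Phi>\<close> and \<open>\<star>\<close> commutes with the action of skew endomorphisms, \<open>\<delta>\<Phi>\<close> is the
  sum of the contractions of \<open>B\<^sub>k \<cdot> \<Phi>\<close> with \<open>e\<^sub>k\<close>. These facts are tensorial, so they can be evaluated in any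
  adapted frame at \<open>x\<close>, in particular in the one that defines the Hodge star there.

  The rest is linear algebra. \<open>\<Lambda>\<^sup>2\<^sub>7\<close> is spanned by seven complex structures \<open>J\<^sub>i\<close> with
  \<open>J\<^sub>iJ\<^sub>j + J\<^sub>jJ\<^sub>i = -2\<delta>\<^sub>i\<^sub>j\<close>, and \<open>\<Phi>(a,b,c,d) = \<Sum>\<^sub>i g(J\<^sub>ia,b) g(J\<^sub>ic,d) - g(a,c) g(b,d) + g(a,d) g(b,c)\<close>.
  The antisymmetry of the left-hand side gives \<open>\<Sum>\<^sub>i J\<^sub>i B J\<^sub>i = 8 B\<^sub>7 - 3 B\<close> for skew \<open>B\<close>. With the Clifford
  relations this shows that the coefficient of \<open>X\<lrcorner>\<delta>\<Phi>\<close> along \<open>J\<^sub>i\<close> is, up to normalisation,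
  \<open>4 \<Sum>\<^sub>k g([J\<^sub>i, (B\<^sub>k)\<^sub>7] e\<^sub>k, X)\<close> and that \<open>\<theta> = -(16/7) \<Sum>\<^sub>k (B\<^sub>k)\<^sub>7 e\<^sub>k\<close>; the first formula follows from the
  Clifford relations once more. For the second, \<open>(\<delta>\<Phi>)\<^sub>8 = - \<theta>\<lrcorner>\<Phi>\<close>, whose contraction with \<open>X\<close> has
  \<open>\<Lambda>\<^sup>2\<^sub>7\<close>-component \<open>3 (X \<and> \<theta>)\<^sub>7\<close>.\<close>

section \<open>Wedge product and contraction\<close>

lemma contract_apply: "contract v \<omega> vs = \<omega> (v # vs)"
  by (simp add: contract_def)

lemma wedge_Nil [simp]: "wedge \<alpha> \<beta> [] = \<alpha> [] * \<beta> []"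
  by (simp add: wedge_def)

lemma forms_lengthD: "\<omega> \<in> forms k \<Longrightarrow> length vs \<noteq> k \<Longrightarrow> \<omega> vs = 0"
  by (simp add: forms_def)

text \<open>Sorts the subsets of \<open>{..<Suc n}\<close> by membership of 0. In the shuffle sum
  this decides which factor receives the first argument.\<close>

lemma sum_Pow_lessThan_Suc:
  fixes f :: "nat set \<Rightarrow> real"
  shows "sum f (Pow {..<Suc n}) = (\<Sum>T\<in>Pow {..<n}. f (insert 0 (Suc ` T)) + f (Suc ` T))"
proof -
  let ?P = "image Suc ` Pow {..<n}"
  have P: "Pow (Suc ` {..<n}) = ?P"
    by (rule image_Pow_surj[symmetric]) simp
  have 1: "Pow {..<Suc n} = ?P \<union> insert 0 ` ?P"
    unfolding lessThan_Suc_eq_insert_0 Pow_insert P ..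
  have "sum f (Pow {..<Suc n}) = sum f ?P + sum f (insert 0 ` ?P)"
    unfolding 1 by (rule sum.union_disjoint) auto
  also have "sum f (insert 0 ` ?P) = sum (f \<circ> insert 0) ?P"
    by (rule sum.reindex) (auto simp: inj_on_def)
  also have "sum (f \<circ> insert 0) ?P = (\<Sum>T\<in>Pow {..<n}. f (insert 0 (Suc ` T)))"
    by (subst sum.reindex) (auto simp: inj_on_def inj_image_eq_iff)
  also have "sum f ?P = (\<Sum>T\<in>Pow {..<n}. f (Suc ` T))"
    by (subst sum.reindex) (auto simp: inj_on_def inj_image_eq_iff)
  finally show ?thesis by (simp add: sum.distrib)
qed

text \<open>Contraction is an antiderivation. This replaces the shuffle sum by a recursion on the
  argument list, from which associativity and commutation follow by induction.\<close>

lemma wedge_Cons: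
  assumes "\<alpha> \<in> forms p"
  shows "wedge \<alpha> \<beta> (v # vs) = wedge (contract v \<alpha>) \<beta> vs + (-1) ^ p * wedge \<alpha> (contract v \<beta>) vs"
proof -
  define n where "n = length vs"
  let ?inv = "\<lambda>m S. {(i, j). i \<in> S \<and> j \<in> {..<m} - S \<and> j < i}"
  let ?f = "\<lambda>S. (-1) ^ card (?inv (Suc n) S) * \<alpha> (nths (v # vs) S) * \<beta> (nths (v # vs) (- S))"
  have c: "{j. Suc j \<in> - S} = - {j. Suc j \<in> S}" for S by auto
  have f1: "?f (insert 0 (Suc ` T)) =
      (-1) ^ card (?inv n T) * \<alpha> (v # nths vs T) * \<beta> (nths vs (- T))" for T
  proof -
    have "?inv (Suc n) (insert 0 (Suc ` T)) = map_prod Suc Suc ` ?inv n T"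
      by (force simp: image_iff less_Suc_eq_0_disj)
    then have "card (?inv (Suc n) (insert 0 (Suc ` T))) = card (?inv n T)"
      by (simp add: card_image inj_on_def)
    moreover have "{j. Suc j \<in> insert 0 (Suc ` T)} = T" by auto
    ultimately show ?thesis
      unfolding nths_Cons c by simp
  qed
  \<comment> \<open>If \<open>v\<close> goes to the second factor, it passes all
    \<open>card T\<close> arguments of the first, which adds \<open>card T\<close> inversions with
    position 0. This number is \<open>p\<close>, since otherwise \<open>\<alpha>\<close> vanishes
    for degree reasons.\<close>
  have f2: "?f (Suc ` T) =
      (-1) ^ p * ((-1) ^ card (?inv n T) * \<alpha> (nths vs T) * \<beta> (v # nths vs (- T)))"
    if "T \<in> Pow {..<n}" for T
  proof (cases "card T = p")
    case True
    have fin: "finite T" using that by (auto intro: finite_subset)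
    have "?inv (Suc n) (Suc ` T) = map_prod Suc Suc ` ?inv n T \<union> Suc ` T \<times> {0}"
      by (force simp: image_iff less_Suc_eq_0_disj)
    moreover have "finite (?inv n T)"
      by (rule finite_subset[of _ "T \<times> {..<n}"]) (use fin in auto)
    moreover have "map_prod Suc Suc ` ?inv n T \<inter> Suc ` T \<times> {0} = {}" by auto
    ultimately have "card (?inv (Suc n) (Suc ` T)) = card (?inv n T) + p"
      using fin True by (simp add: card_Un_disjoint card_image inj_on_def)
    moreover have "{j. Suc j \<in> Suc ` T} = T" by auto
    ultimately show ?thesis
      unfolding nths_Cons c by (simp add: power_add)
  next
    case False
    have "{i. i < length vs \<and> i \<in> T} = T" using that by (auto simp: n_def)
    then have "length (nths vs T) \<noteq> p" using False by (simp add: length_nths)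
    then have "\<alpha> (nths vs T) = 0" using assms by (rule forms_lengthD[rotated])
    moreover have "{j. Suc j \<in> Suc ` T} = T" by auto
    ultimately show ?thesis
      unfolding nths_Cons c by simp
  qed
  have "wedge \<alpha> \<beta> (v # vs) = sum ?f (Pow {..<Suc n})"
    by (simp add: wedge_def n_def)
  also have "\<dots> = (\<Sum>T\<in>Pow {..<n}. (-1) ^ card (?inv n T) * \<alpha> (v # nths vs T) * \<beta> (nths vs (- T))
      + (-1) ^ p * ((-1) ^ card (?inv n T) * \<alpha> (nths vs T) * \<beta> (v # nths vs (- T))))"
    unfolding sum_Pow_lessThan_Suc using f1 f2 by (intro sum.cong) simp_all
  also have "\<dots> = wedge (contract v \<alpha>) \<beta> vs + (-1) ^ p * wedge \<alpha> (contract v \<beta>) vs"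
    by (simp add: wedge_def n_def sum.distrib sum_distrib_left contract_apply)
  finally show ?thesis .
qed

lemma wedge_add_left: "wedge (\<lambda>vs. \<alpha> vs + \<alpha>' vs) \<beta> vs = wedge \<alpha> \<beta> vs + wedge \<alpha>' \<beta> vs"
  by (simp add: wedge_def algebra_simps sum.distrib)

lemma wedge_add_right: "wedge \<alpha> (\<lambda>vs. \<beta> vs + \<beta>' vs) vs = wedge \<alpha> \<beta> vs + wedge \<alpha> \<beta>' vs"
  by (simp add: wedge_def algebra_simps sum.distrib)

lemma wedge_diff_left: "wedge (\<lambda>vs. \<alpha> vs - \<alpha>' vs) \<beta> vs = wedge \<alpha> \<beta> vs - wedge \<alpha>' \<beta> vs"
  by (simp add: wedge_def algebra_simps sum_subtractf)

lemma wedge_diff_right: "wedge \<alpha> (\<lambda>vs. \<beta> vs - \<beta>' vs) vs = wedge \<alpha> \<beta> vs - wedge \<alpha> \<beta>' vs"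
  by (simp add: wedge_def algebra_simps sum_subtractf)

lemma wedge_scale_left: "wedge (\<lambda>vs. c * \<alpha> vs) \<beta> vs = c * wedge \<alpha> \<beta> vs"
  by (simp add: wedge_def algebra_simps sum_distrib_left)

lemma wedge_scale_right: "wedge \<alpha> (\<lambda>vs. c * \<beta> vs) vs = c * wedge \<alpha> \<beta> vs"
  by (simp add: wedge_def algebra_simps sum_distrib_left)

lemma wedge_minus_left: "wedge (\<lambda>vs. - \<alpha> vs) \<beta> vs = - wedge \<alpha> \<beta> vs"
  using wedge_scale_left[of "-1"] by simp

lemma wedge_minus_right: "wedge \<alpha> (\<lambda>vs. - \<beta> vs) vs = - wedge \<alpha> \<beta> vs"
  using wedge_scale_right[of _ "-1"] by simp

lemma wedge_0_left [simp]: "wedge (\<lambda>_. 0) \<beta> vs = 0"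
  by (simp add: wedge_def)

lemma wedge_0_right [simp]: "wedge \<alpha> (\<lambda>_. 0) vs = 0"
  by (simp add: wedge_def)

lemma wedge_sum_left: "wedge (\<lambda>vs. \<Sum>i\<in>I. \<alpha> i vs) \<beta> vs = (\<Sum>i\<in>I. wedge (\<alpha> i) \<beta> vs)"
  by (induction I rule: infinite_finite_induct) (simp_all add: wedge_add_left)

lemma wedge_sum_right: "wedge \<alpha> (\<lambda>vs. \<Sum>i\<in>I. \<beta> i vs) vs = (\<Sum>i\<in>I. wedge \<alpha> (\<beta> i) vs)"
  by (induction I rule: infinite_finite_induct) (simp_all add: wedge_add_right)

lemmas wedge_linear = wedge_add_left wedge_add_right wedge_diff_left wedge_diff_right
  wedge_scale_left wedge_scale_right wedge_minus_left wedge_minus_right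
  wedge_sum_left wedge_sum_right

section \<open>Forms under linear operations, contraction and wedge products\<close>

lemma forms_zero [simp]: "(\<lambda>_. 0) \<in> forms k"
  by (simp add: forms_def linear_zero)

lemma forms_add: "\<alpha> \<in> forms k \<Longrightarrow> \<beta> \<in> forms k \<Longrightarrow> (\<lambda>vs. \<alpha> vs + \<beta> vs) \<in> forms k"
  by (simp add: forms_def linear_compose_add)

lemma forms_scale: "\<alpha> \<in> forms k \<Longrightarrow> (\<lambda>vs. c * \<alpha> vs) \<in> forms k"
  using linear_compose_scale_right[where c=c and 'b=real] by (force simp add: forms_def)

lemma forms_minus: "\<alpha> \<in> forms k \<Longrightarrow> (\<lambda>vs. - \<alpha> vs) \<in> forms k"
  using forms_scale[of _ _ "-1"] by simp

lemma forms_diff: "\<alpha> \<in> forms k \<Longrightarrow> \<beta> \<in> forms k \<Longrightarrow> (\<lambda>vs. \<alpha> vs - \<beta> vs) \<in> forms k"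
  using forms_add[OF _ forms_minus] by simp

lemma forms_sum: "(\<And>i. i \<in> I \<Longrightarrow> \<alpha> i \<in> forms k) \<Longrightarrow> (\<lambda>vs. \<Sum>i\<in>I. \<alpha> i vs) \<in> forms k"
  by (induction I rule: infinite_finite_induct) (simp_all add: forms_add)

lemma forms_0_iff: "\<omega> \<in> forms 0 \<longleftrightarrow> (\<forall>v vs. \<omega> (v # vs) = 0)"
  unfolding forms_def by (auto simp: neq_Nil_conv) (metis distinct.simps(1) neq_Nil_conv)

lemma contract_forms_0: "\<omega> \<in> forms 0 \<Longrightarrow> contract v \<omega> = (\<lambda>_. 0)"
  by (auto simp: forms_0_iff contract_apply)

lemma contract_forms: "\<omega> \<in> forms (Suc k) \<Longrightarrow> contract v \<omega> \<in> forms k"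
  unfolding forms_def by (force simp: contract_apply simp flip: append_Cons)

lemma contract_forms': "\<omega> \<in> forms k \<Longrightarrow> contract v \<omega> \<in> forms (k - 1)"
  by (cases k) (simp_all add: contract_forms_0 contract_forms)

lemma contract_contract: "\<omega> \<in> forms k \<Longrightarrow> contract v (contract v \<omega>) = (\<lambda>_. 0)"
  by (rule ext) (simp add: forms_def contract_apply)

lemma forms_linear:
  assumes "\<omega> \<in> forms k"
  shows "linear (\<lambda>v. \<omega> (us @ v # ws))"
proof (cases "length us + length ws + 1 = k")
  case True
  then show ?thesis using assms by (simp add: forms_def)
next
  case False
  then have "(\<lambda>v. \<omega> (us @ v # ws)) = (\<lambda>_. 0)"
    using assms by (auto simp: forms_def)
  then show ?thesis by (simp add: linear_zero)
qed

lemma forms_linear_Cons: "\<omega> \<in> forms k \<Longrightarrow> linear (\<lambda>v. \<omega> (v # ws))"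
  using forms_linear[of \<omega> k "[]"] by simp

lemma form_swap:
  assumes "\<omega> \<in> forms k"
  shows "\<omega> (u # v # ws) = - \<omega> (v # u # ws)"
proof -
  have l1: "linear (\<lambda>u. \<omega> (u # x # ws))" for x
    using forms_linear[OF assms, of "[]"] by simp
  have l2: "linear (\<lambda>v. \<omega> (x # v # ws))" for x
    using forms_linear[OF assms, of "[x]"] by simp
  have z: "\<omega> (x # x # ws) = 0" for x
    using assms by (simp add: forms_def)
  have "0 = \<omega> ((u + v) # (u + v) # ws)" by (simp add: z)
  also have "\<dots> = \<omega> (u # v # ws) + \<omega> (v # u # ws)"
    unfolding linear_add[OF l1] linear_add[OF l2] by (simp add: z)
  finally show ?thesis by simp
qed

text \<open>The counterpart of \<open>form_swap\<close> for an \<open>\<omega>\<close> not yet known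
  to be a form, as it occurs in \<open>forms_SucI\<close>.\<close>

lemma form_neg_contract:
  assumes l: "\<And>v. contract v \<omega> \<in> forms k"
    and lin: "\<And>vs. linear (\<lambda>v. \<omega> (v # vs))"
    and z: "\<And>v vs. \<omega> (v # v # vs) = 0"
  shows "\<omega> (u # v # ws) = - \<omega> (v # u # ws)"
proof -
  have l2: "linear (\<lambda>v. \<omega> (x # v # ws))" for x
    using forms_linear[OF l[of x], of "[]" ws] by (simp add: contract_apply)
  have "0 = \<omega> ((u + v) # (u + v) # ws)" by (simp add: z)
  also have "\<dots> = \<omega> (u # v # ws) + \<omega> (v # u # ws)"
    unfolding linear_add[OF lin] linear_add[OF l2] by (simp add: z)
  finally show ?thesis by simp
qed

text \<open>A recursive criterion for forms. Alternation is checked on the first two arguments only: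
  any other repetition lies inside a contraction, if necessary after swapping the first two
  arguments.\<close>

lemma forms_SucI:
  assumes nil: "\<omega> [] = 0"
    and l: "\<And>v. contract v \<omega> \<in> forms k"
    and lin: "\<And>vs. linear (\<lambda>v. \<omega> (v # vs))"
    and z: "\<And>v vs. \<omega> (v # v # vs) = 0"
  shows "\<omega> \<in> forms (Suc k)"
proof -
  have "\<omega> vs = 0" if "length vs \<noteq> Suc k" for vs
    using that nil forms_lengthD[OF l] by (cases vs) (auto simp: contract_apply)
  moreover have "linear (\<lambda>v. \<omega> (us @ v # ws))" for us ws
    using lin forms_linear[OF l] by (cases us) (auto simp: contract_apply)
  moreover have "\<omega> vs = 0" if "\<not> distinct vs" for vs
  proof (cases vs)
    case (Cons v us)
    have cd: "\<omega> (u # vs) = 0" if "\<not> distinct vs" for u vs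
      using l[of u] that by (simp add: forms_def contract_apply)
    show ?thesis
    proof (cases "distinct us")
      case True
      then have "v \<in> set us" using \<open>\<not> distinct vs\<close> Cons by simp
      then obtain w ws where us: "us = w # ws" by (cases us) auto
      show ?thesis
      proof (cases "w = v")
        case False
        then have "\<not> distinct (v # ws)" using \<open>v \<in> set us\<close> us by simp
        then have "\<omega> (w # v # ws) = 0" by (rule cd)
        then show ?thesis using form_neg_contract[OF l lin z, of v w ws] Cons us by simp
      qed (simp add: Cons us z)
    qed (simp add: Cons cd)
  qed (use that in simp)
  ultimately show ?thesis by (simp add: forms_def)
qed

lemma wedge_contract_left_linear:
  assumes "\<alpha> \<in> forms p"
  shows "linear (\<lambda>v. wedge (contract v \<alpha>) \<beta> vs)"
proof (rule linearI)
  note l = forms_linear_Cons[OF assms]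
  fix u v c
  have "contract (u + v) \<alpha> = (\<lambda>vs. contract u \<alpha> vs + contract v \<alpha> vs)"
    using linear_add[OF l] by (auto simp: contract_apply)
  then show "wedge (contract (u + v) \<alpha>) \<beta> vs = wedge (contract u \<alpha>) \<beta> vs + wedge (contract v \<alpha>) \<beta> vs"
    using wedge_add_left by metis
  have "contract (c *\<^sub>R v) \<alpha> = (\<lambda>vs. c * contract v \<alpha> vs)"
    using linear_scale[OF l] by (auto simp: contract_apply)
  then show "wedge (contract (c *\<^sub>R v) \<alpha>) \<beta> vs = c *\<^sub>R wedge (contract v \<alpha>) \<beta> vs"
    using wedge_scale_left by (metis real_scaleR_def)
qed

lemma wedge_contract_right_linear:
  assumes "\<beta> \<in> forms p"
  shows "linear (\<lambda>v. wedge \<alpha> (contract v \<beta>) vs)"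
proof (rule linearI)
  note l = forms_linear_Cons[OF assms]
  fix u v c
  have "contract (u + v) \<beta> = (\<lambda>vs. contract u \<beta> vs + contract v \<beta> vs)"
    using linear_add[OF l] by (auto simp: contract_apply)
  then show "wedge \<alpha> (contract (u + v) \<beta>) vs = wedge \<alpha> (contract u \<beta>) vs + wedge \<alpha> (contract v \<beta>) vs"
    using wedge_add_right by metis
  have "contract (c *\<^sub>R v) \<beta> = (\<lambda>vs. c * contract v \<beta> vs)"
    using linear_scale[OF l] by (auto simp: contract_apply)
  then show "wedge \<alpha> (contract (c *\<^sub>R v) \<beta>) vs = c *\<^sub>R wedge \<alpha> (contract v \<beta>) vs"
    using wedge_scale_right by (metis real_scaleR_def)
qed

lemma contract_wedge:
  assumes "\<alpha> \<in> forms p"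
  shows "contract v (wedge \<alpha> \<beta>) =
    (\<lambda>vs. wedge (contract v \<alpha>) \<beta> vs + (-1) ^ p * wedge \<alpha> (contract v \<beta>) vs)"
  using wedge_Cons[OF assms] by (auto simp: contract_apply)

text \<open>Induction on the total degree: \<open>forms_SucI\<close> reduces the claim to
  contractions, which \<open>wedge_Cons\<close> expresses by products of degree one less.\<close>

lemma wedge_forms:
  assumes "\<alpha> \<in> forms p" "\<beta> \<in> forms q"
  shows "wedge \<alpha> \<beta> \<in> forms (p + q)"
  using assms
proof (induction "p + q" arbitrary: p q \<alpha> \<beta>)
  case 0
  then show ?case
    by (simp add: forms_0_iff wedge_Cons[where p=0] contract_forms_0)
next
  case (Suc n)
  have 1: "wedge (contract v \<alpha>) \<beta> \<in> forms n" for v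
  proof (cases p)
    case 0
    then show ?thesis using Suc.prems by (simp add: contract_forms_0 wedge_def)
  next
    case (Suc p')
    then show ?thesis using Suc.hyps Suc.prems contract_forms by auto
  qed
  have 2: "wedge \<alpha> (contract v \<beta>) \<in> forms n" for v
  proof (cases q)
    case 0
    then show ?thesis using Suc.prems by (simp add: contract_forms_0 wedge_def)
  next
    case (Suc q')
    have "n = p + q'" using Suc.hyps(2) Suc by simp
    with Suc.hyps(1)[OF this Suc.prems(1) contract_forms] Suc.prems(2) Suc
    show ?thesis by simp
  qed
  have "wedge \<alpha> \<beta> \<in> forms (Suc n)"
  proof (rule forms_SucI)
    have "p \<noteq> 0 \<or> q \<noteq> 0" using Suc.hyps(2) by auto
    then show "wedge \<alpha> \<beta> [] = 0"
      using Suc.prems by (auto simp: forms_lengthD)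
  next
    fix v
    show "contract v (wedge \<alpha> \<beta>) \<in> forms n"
      unfolding contract_wedge[OF Suc.prems(1)]
      by (intro forms_add forms_scale 1 2)
  next
    fix vs
    show "linear (\<lambda>v. wedge \<alpha> \<beta> (v # vs))"
      unfolding wedge_Cons[OF Suc.prems(1)]
      using linear_compose_scale_right[OF wedge_contract_right_linear[OF Suc.prems(2)], of "(-1) ^ p"]
      by (intro linear_compose_add wedge_contract_left_linear[OF Suc.prems(1)]) simp
  next
    fix v vs
    show "wedge \<alpha> \<beta> (v # v # vs) = 0"
    proof (cases p)
      case 0
      then have *: "\<alpha> \<in> forms 0" using Suc.prems by simp
      then show ?thesis
        by (simp add: wedge_Cons contract_forms_0 contract_contract[OF Suc.prems(2)])
    next
      \<comment> \<open>Contracting twice with \<open>v\<close> leaves two mixed products with the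
        signs \<open>(-1) ^ p\<close> and \<open>(-1) ^ p'\<close>, which cancel.\<close>
      case (Suc p')
      have *: "contract v \<alpha> \<in> forms p'" using Suc Suc.prems contract_forms by blast
      show ?thesis using Suc
        by (simp add: wedge_Cons[OF Suc.prems(1)] wedge_Cons[OF *] algebra_simps
            contract_contract[OF Suc.prems(1)] contract_contract[OF Suc.prems(2)])
    qed
  qed
  then show ?case using Suc.hyps(2) by simp
qed

lemma wedge_forms_0:
  assumes "\<alpha> \<in> forms 0"
  shows "wedge \<alpha> \<omega> vs = \<alpha> [] * \<omega> vs"
  by (induction vs arbitrary: \<omega>) (simp_all add: contract_apply wedge_Cons[OF assms] contract_forms_0[OF assms])

lemma wedge1_Cons:
  assumes "\<alpha> \<in> forms 1"
  shows "wedge \<alpha> \<omega> (v # vs) = \<alpha> [v] * \<omega> vs - wedge \<alpha> (contract v \<omega>) vs"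
proof -
  have "contract v \<alpha> \<in> forms 0" using contract_forms assms by simp
  then show ?thesis by (simp add: contract_apply wedge_Cons[OF assms] wedge_forms_0)
qed

lemma wedge1_forms: "\<alpha> \<in> forms 1 \<Longrightarrow> \<omega> \<in> forms k \<Longrightarrow> wedge \<alpha> \<omega> \<in> forms (Suc k)"
  using wedge_forms[of \<alpha> 1 \<omega> k] by simp

lemma contract_wedge1:
  "\<alpha> \<in> forms 1 \<Longrightarrow> contract v (wedge \<alpha> \<omega>) = (\<lambda>vs. \<alpha> [v] * \<omega> vs - wedge \<alpha> (contract v \<omega>) vs)"
  by (auto simp: wedge1_Cons contract_apply)

text \<open>Both sides obey the same recursion under contraction. A 1-form on the left is the case
  in which a coframe factor is peeled off a product, as in \<open>hdg_wedge_phi\<close>.\<close>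

lemma wedge1_assoc:
  assumes "\<alpha> \<in> forms 1" "\<beta> \<in> forms q"
  shows "wedge (wedge \<alpha> \<beta>) \<gamma> vs = wedge \<alpha> (wedge \<beta> \<gamma>) vs"
  using assms(2)
proof (induction vs arbitrary: q \<beta> \<gamma>)
  case (Cons v vs)
  have w: "wedge \<alpha> \<beta> \<in> forms (Suc q)" using wedge1_forms[OF assms(1) Cons.prems] .
  show ?case
    unfolding wedge_Cons[OF w] wedge1_Cons[OF assms(1)] contract_wedge1[OF assms(1)]
      contract_wedge[OF Cons.prems]
    by (simp add: wedge_linear Cons.IH[OF Cons.prems] Cons.IH[OF contract_forms'[OF Cons.prems]])
qed simp

lemma wedge1_anticommute:
  assumes "\<alpha> \<in> forms 1" "\<beta> \<in> forms 1"
  shows "wedge \<alpha> (wedge \<beta> \<omega>) vs = - wedge \<beta> (wedge \<alpha> \<omega>) vs"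
proof (induction vs arbitrary: \<omega>)
  case Nil
  then show ?case using assms by (simp add: forms_lengthD)
next
  case (Cons v vs)
  then show ?case
    by (simp add: wedge1_Cons[OF assms(1)] wedge1_Cons[OF assms(2)]
        contract_wedge1[OF assms(1)] contract_wedge1[OF assms(2)] wedge_linear)
qed

lemma wedge_commute:
  assumes "\<alpha> \<in> forms p" "\<beta> \<in> forms q"
  shows "wedge \<alpha> \<beta> vs = (-1) ^ (p * q) * wedge \<beta> \<alpha> vs"
  using assms
proof (induction vs arbitrary: p q \<alpha> \<beta>)
  case Nil
  then show ?case by (cases "p = 0"; cases "q = 0") (auto simp: forms_lengthD)
next
  case (Cons v vs)
  have 1: "wedge (contract v \<alpha>) \<beta> vs = (-1) ^ (p * q) * (-1) ^ q * wedge \<beta> (contract v \<alpha>) vs"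
  proof (cases p)
    case (Suc p')
    have "(-1::real) ^ (p * q) * (-1) ^ q = (-1) ^ (p' * q)"
      by (simp add: Suc power_add mult.left_commute flip: power_mult_distrib)
    with Cons.IH[OF contract_forms Cons.prems(2)] Cons.prems(1) Suc show ?thesis by simp
  qed (use Cons.prems in \<open>simp add: contract_forms_0\<close>)
  have 2: "(-1) ^ p * wedge \<alpha> (contract v \<beta>) vs = (-1) ^ (p * q) * wedge (contract v \<beta>) \<alpha> vs"
  proof (cases q)
    case (Suc q')
    have "(-1::real) ^ p * (-1) ^ (p * q') = (-1) ^ (p * q)"
      by (simp add: Suc power_add)
    with Cons.IH[OF Cons.prems(1) contract_forms] Cons.prems(2) Suc show ?thesis
      by (metis mult.assoc)
  qed (use Cons.prems in \<open>simp add: contract_forms_0\<close>)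
  show ?case
    unfolding wedge_Cons[OF Cons.prems(1)] wedge_Cons[OF Cons.prems(2)]
    by (simp add: 1 2 distrib_left)
qed

text \<open>This is the shape of \<open>ext_deriv\<close>, so that \<open>codiff_\<phi>\<close> can
  recognise the exterior derivative as a sum of wedge products with the coframe.\<close>

lemma wedge1_expand:
  assumes "\<alpha> \<in> forms 1"
  shows "wedge \<alpha> \<omega> vs =
    (\<Sum>i<length vs. (-1) ^ i * \<alpha> [vs ! i] * \<omega> (take i vs @ drop (Suc i) vs))"
proof (induction vs arbitrary: \<omega>)
  case Nil
  then show ?case using assms by (simp add: forms_lengthD)
next
  case (Cons v vs)
  show ?case
    unfolding wedge1_Cons[OF assms] Cons.IH
    by (simp add: lessThan_Suc_eq_insert_0 sum.reindex sum_negf[symmetric] contract_apply)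
qed

lemma form_move:
  assumes "\<omega> \<in> forms k"
  shows "\<omega> (us @ v # ws) = (-1) ^ length us * \<omega> (v # us @ ws)"
  using assms
proof (induction us arbitrary: \<omega> k)
  case (Cons u us)
  have "\<omega> ((u # us) @ v # ws) = contract u \<omega> (us @ v # ws)" by (simp add: contract_apply)
  also have "\<dots> = (-1) ^ length us * contract u \<omega> (v # us @ ws)"
    by (rule Cons.IH[OF contract_forms'[OF Cons.prems]])
  also have "\<dots> = (-1) ^ length (u # us) * \<omega> (v # (u # us) @ ws)"
    using form_swap[OF Cons.prems, of u v "us @ ws"] by (simp add: contract_apply)
  finally show ?case .
qed simp

section \<open>The action of an endomorphism on forms\<close>

text \<open>The derivation of the exterior algebra that is the transpose of \<open>C\<close> on
  1-forms. The usual action of an endomorphism on forms is its negative.\<close>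

definition derivation :: "(real^8 \<Rightarrow> real^8) \<Rightarrow> form \<Rightarrow> form" where
  "derivation C \<omega> = (\<lambda>vs. \<Sum>k<length vs. \<omega> (vs[k := C (vs ! k)]))"

lemma derivation_Nil [simp]: "derivation C \<omega> [] = 0"
  by (simp add: derivation_def)

lemma derivation_Cons: "derivation C \<omega> (v # vs) = \<omega> (C v # vs) + derivation C (contract v \<omega>) vs"
  unfolding derivation_def by (simp add: lessThan_Suc_eq_insert_0 sum.reindex contract_apply)

lemma derivation_contract:
  "derivation C (contract v \<omega>) = (\<lambda>vs. contract v (derivation C \<omega>) vs - contract (C v) \<omega> vs)"
  by (auto simp: derivation_Cons contract_apply)

lemma derivation_diff:
  "derivation C (\<lambda>vs. \<alpha> vs - \<beta> vs) vs = derivation C \<alpha> vs - derivation C \<beta> vs"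
  by (simp add: derivation_def sum_subtractf)

lemma derivation_scale: "derivation C (\<lambda>vs. c * \<alpha> vs) vs = c * derivation C \<alpha> vs"
  by (simp add: derivation_def sum_distrib_left)

lemma derivation_forms1_apply:
  assumes "\<alpha> \<in> forms 1"
  shows "derivation C \<alpha> vs = (case vs of [v] \<Rightarrow> \<alpha> [C v] | _ \<Rightarrow> 0)"
proof (cases "length vs = 1")
  case True
  then show ?thesis by (auto simp: derivation_def length_Suc_conv)
next
  case False
  then have "derivation C \<alpha> vs = 0"
    using assms by (simp add: derivation_def forms_lengthD)
  with False show ?thesis by (auto split: list.split)
qed

lemma derivation_forms1:
  assumes "\<alpha> \<in> forms 1" "linear C"
  shows "derivation C \<alpha> \<in> forms 1"
proof -
  have "derivation C \<alpha> \<in> forms (Suc 0)"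
  proof (rule forms_SucI)
    fix vs
    have "linear (\<lambda>v. \<alpha> [C v])"
      using linear_compose[OF assms(2) forms_linear_Cons[OF assms(1), of "[]"]] by (simp add: o_def)
    then show "linear (\<lambda>v. derivation C \<alpha> (v # vs))"
      using derivation_forms1_apply[OF assms(1)] linear_zero by (cases vs) auto
  qed (auto simp: forms_0_iff derivation_forms1_apply[OF assms(1)] contract_apply)
  then show ?thesis by simp
qed

lemma derivation_wedge:
  assumes "\<alpha> \<in> forms 1" "linear C"
  shows "derivation C (wedge \<alpha> \<omega>) vs = wedge (derivation C \<alpha>) \<omega> vs + wedge \<alpha> (derivation C \<omega>) vs"
proof (induction vs arbitrary: \<omega>)
  case Nil
  then show ?case using assms by (simp add: forms_lengthD)
next
  case (Cons v vs)
  show ?case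
    unfolding derivation_Cons contract_wedge1[OF assms(1)] wedge1_Cons[OF assms(1)]
      wedge1_Cons[OF derivation_forms1[OF assms]]
    unfolding derivation_diff derivation_scale Cons.IH derivation_contract
    by (simp add: wedge_linear derivation_forms1_apply[OF assms(1)]
        contract_apply[of "C v" \<omega> vs] contract_apply[of v "derivation C \<alpha>"] contract_apply[of "C v" \<alpha>])
qed


section \<open>The Hodge star in an orthonormal frame\<close>

lemma flat_apply [simp]: "flat G u [v] = G u v"
  by (simp add: flat_def)

lemma wedge_forms1_zero:
  assumes "\<alpha> \<in> forms 1" "\<forall>u\<in>set us. \<alpha> [u] = 0"
  shows "wedge \<alpha> \<omega> us = 0"
  using assms(2)
proof (induction us arbitrary: \<omega>)
  case Nil
  then show ?case using assms by (simp add: forms_lengthD)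
qed (simp add: wedge1_Cons[OF assms(1)])

lemma wedge_forms1_append:
  assumes "\<alpha> \<in> forms 1" "\<forall>u\<in>set us \<union> set ws. \<alpha> [u] = 0"
  shows "wedge \<alpha> \<omega> (us @ v # ws) = (-1) ^ length us * \<alpha> [v] * \<omega> (us @ ws)"
  using assms(2)
proof (induction us arbitrary: \<omega>)
  case Nil
  then show ?case by (simp add: wedge1_Cons[OF assms(1)] wedge_forms1_zero[OF assms(1)])
qed (simp add: wedge1_Cons[OF assms(1)] contract_apply)

lemma forms_append:
  assumes "\<omega> \<in> forms k"
  shows "(\<lambda>vs. \<omega> (us @ vs)) \<in> forms (k - length us)"
  using assms
proof (induction us arbitrary: k \<omega>)
  case (Cons u us)
  from Cons.IH[OF contract_forms'[OF Cons.prems, of u]] show ?case by (simp add: contract_apply)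
qed simp

lemma insort_split: "\<exists>xs ys. l = xs @ ys \<and> insort j l = xs @ j # ys"
proof (induction l)
  case (Cons a l)
  then obtain xs ys where "l = xs @ ys" "insort j l = xs @ j # ys" by blast
  then have "a # l = (a # xs) @ ys \<and> a # insort j l = (a # xs) @ j # ys" by simp
  moreover have "a # l = [] @ (a # l) \<and> j # a # l = [] @ j # a # l" by simp
  ultimately show ?case unfolding insort_key.simps by (metis (full_types))
qed simp

lemma wedge_fun_linear:
  "wedge (\<lambda>vs. \<alpha> vs + \<alpha>' vs) \<beta> = (\<lambda>vs. wedge \<alpha> \<beta> vs + wedge \<alpha>' \<beta> vs)"
  "wedge \<alpha> (\<lambda>vs. \<beta> vs + \<beta>' vs) = (\<lambda>vs. wedge \<alpha> \<beta> vs + wedge \<alpha> \<beta>' vs)"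
  "wedge (\<lambda>vs. \<alpha> vs - \<alpha>' vs) \<beta> = (\<lambda>vs. wedge \<alpha> \<beta> vs - wedge \<alpha>' \<beta> vs)"
  "wedge \<alpha> (\<lambda>vs. \<beta> vs - \<beta>' vs) = (\<lambda>vs. wedge \<alpha> \<beta> vs - wedge \<alpha> \<beta>' vs)"
  "wedge (\<lambda>vs. c * \<alpha> vs) \<beta> = (\<lambda>vs. c * wedge \<alpha> \<beta> vs)"
  "wedge \<alpha> (\<lambda>vs. c * \<beta> vs) = (\<lambda>vs. c * wedge \<alpha> \<beta> vs)"
  "wedge (\<lambda>vs. - \<alpha> vs) \<beta> = (\<lambda>vs. - wedge \<alpha> \<beta> vs)"
  "wedge \<alpha> (\<lambda>vs. - \<beta> vs) = (\<lambda>vs. - wedge \<alpha> \<beta> vs)"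
  "wedge (\<lambda>vs. \<Sum>i\<in>I. \<gamma> i vs) \<beta> = (\<lambda>vs. \<Sum>i\<in>I. wedge (\<gamma> i) \<beta> vs)"
  "wedge \<alpha> (\<lambda>vs. \<Sum>i\<in>I. \<gamma> i vs) = (\<lambda>vs. \<Sum>i\<in>I. wedge \<alpha> (\<gamma> i) vs)"
  "wedge (\<lambda>_. 0) \<beta> = (\<lambda>_. 0)" "wedge \<alpha> (\<lambda>_. 0) = (\<lambda>_. 0)"
  by (simp_all add: fun_eq_iff wedge_linear)

text \<open>A single inner product space. Positive definiteness is carried by the eight orthonormal
  vectors.\<close>

locale frame8 =
  fixes G :: scalar_product and e :: "nat \<Rightarrow> real^8"
  assumes bilin: "bilinear G"
    and symm: "G u v = G v u"
    and orth: "orthonormal_frame G e"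
begin

lemma G_e: "i < 8 \<Longrightarrow> j < 8 \<Longrightarrow> G (e i) (e j) = (if i = j then 1 else 0)"
  using orth by (simp add: orthonormal_frame_def)

lemma G_lin1: "linear (\<lambda>u. G u v)" and G_lin2: "linear (G u)"
  using bilin by (auto simp: bilinear_def)

lemma G_simps:
  "G (u + v) w = G u w + G v w" "G w (u + v) = G w u + G w v"
  "G (u - v) w = G u w - G v w" "G w (u - v) = G w u - G w v"
  "G (c *\<^sub>R u) w = c * G u w" "G w (c *\<^sub>R u) = c * G w u"
  "G (- u) w = - G u w" "G w (- u) = - G w u"
  "G 0 w = 0" "G w 0 = 0"
  using linear_add[OF G_lin1] linear_add[OF G_lin2] linear_diff[OF G_lin1] linear_diff[OF G_lin2]
    linear_scale[OF G_lin1] linear_scale[OF G_lin2] linear_neg[OF G_lin1] linear_neg[OF G_lin2]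
    linear_0[OF G_lin1] linear_0[OF G_lin2]
  by simp_all

lemma G_sum1: "G (sum f A) w = (\<Sum>i\<in>A. G (f i) w)"
  by (rule linear_sum[OF G_lin1])

lemma G_sum2: "G w (sum f A) = (\<Sum>i\<in>A. G w (f i))"
  by (rule linear_sum[OF G_lin2])

lemma sum_e:
  assumes "j < 8"
  shows "(\<Sum>i<8. c i * G (e i) (e j)) = c j"
proof -
  have "(\<Sum>i<8. c i * G (e i) (e j)) = (\<Sum>i<8. if i = j then c i else 0)"
    using assms by (intro sum.cong) (auto simp: G_e)
  then show ?thesis using assms by simp
qed

text \<open>Orthonormality gives linear independence, and eight independent vectors span
  \<open>real^8\<close>.\<close>

lemma expand: "v = (\<Sum>i<8. G v (e i) *\<^sub>R e i)"
proof -
  have inj: "inj_on e {..<8}"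
    by (rule inj_onI) (metis G_e lessThan_iff zero_neq_one)
  have "independent (e ` {..<8})"
  proof (rule independent_if_scalars_zero)
    fix f x assume s: "(\<Sum>x\<in>e ` {..<8}. f x *\<^sub>R x) = 0" and "x \<in> e ` {..<8}"
    then obtain j where j: "j < 8" "x = e j" by auto
    have "0 = G (\<Sum>i<8. f (e i) *\<^sub>R e i) (e j)"
      using s by (simp add: sum.reindex[OF inj] G_simps)
    also have "\<dots> = f (e j)"
      unfolding G_sum1 G_simps using j by (rule_tac sum_e)
    finally show "f x = 0" using j by simp
  qed simp
  moreover have "card (e ` {..<8}) = 8" by (simp add: card_image inj)
  ultimately have "UNIV \<subseteq> span (e ` {..<8})"
    by (intro card_ge_dim_independent) auto
  then have "v \<in> span (e ` {..<8})" by blast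
  then obtain f where f: "v = (\<Sum>x\<in>e ` {..<8}. f x *\<^sub>R x)"
    by (auto simp: span_finite)
  then have v: "v = (\<Sum>i<8. f (e i) *\<^sub>R e i)" by (simp add: sum.reindex[OF inj])
  have "G v (e j) = f (e j)" if "j < 8" for j
    by (subst v) (simp only: G_sum1 G_simps sum_e[OF that])
  with v show ?thesis by simp
qed

lemma linear_expand:
  assumes "linear f"
  shows "f v = (\<Sum>i<8. G v (e i) *\<^sub>R f (e i))"
  by (subst expand[of v]) (simp add: linear_sum[OF assms] linear_scale[OF assms])

lemma linear_expand_real:
  fixes f :: "real^8 \<Rightarrow> real"
  assumes "linear f"
  shows "(\<Sum>i<8. G v (e i) * f (e i)) = f v"
  using linear_expand[OF assms, of v] by simp

lemma linear_expand_real':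
  fixes f :: "real^8 \<Rightarrow> real"
  assumes "linear f"
  shows "(\<Sum>i<8. G (e i) v * f (e i)) = f v"
  using linear_expand_real[OF assms] by (simp add: symm)

lemma parseval: "(\<Sum>i<8. G u (e i) * G v (e i)) = G u v"
  using linear_expand_real[OF G_lin2, of u v] by (simp add: symm)

lemma linear_eq_on_frame:
  assumes "linear f" "linear h" "\<And>i. i < 8 \<Longrightarrow> f (e i) = h (e i)"
  shows "f v = h v"
  using linear_expand[OF assms(1), of v] linear_expand[OF assms(2), of v] assms(3) by simp

lemma G_eqI: "(\<And>i. i < 8 \<Longrightarrow> G u (e i) = G v (e i)) \<Longrightarrow> u = v"
  using expand[of u] expand[of v] by simp

lemma form_expand: "\<omega> \<in> forms k \<Longrightarrow> (\<Sum>i<8. G v (e i) * \<omega> (e i # vs)) = \<omega> (v # vs)"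
  by (rule linear_expand_real[OF forms_linear_Cons])

text \<open>By multilinearity; contracting with one frame vector at a time keeps the induction
  within forms.\<close>

lemma forms_eq_0_on_frame:
  assumes "\<omega> \<in> forms k" "\<And>is. length is = k \<Longrightarrow> set is \<subseteq> {..<8} \<Longrightarrow> \<omega> (map e is) = 0"
  shows "\<omega> vs = 0"
  using assms
proof (induction vs arbitrary: k \<omega>)
  case Nil
  then show ?case using forms_lengthD[OF Nil(1), of "[]"] Nil(2)[of "[]"] by fastforce
next
  case (Cons v vs)
  show ?case
  proof (cases k)
    case 0
    then show ?thesis using Cons.prems by (simp add: forms_0_iff)
  next
    case (Suc k')
    have "contract (e i) \<omega> vs = 0" if "i < 8" for i
    proof (rule Cons.IH[of _ k'])
      show "contract (e i) \<omega> \<in> forms k'" using Cons.prems(1) Suc contract_forms by blast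
      show "contract (e i) \<omega> (map e is) = 0" if "length is = k'" "set is \<subseteq> {..<8}" for "is"
        using Cons.prems(2)[of "i # is"] that \<open>i < 8\<close> Suc by (simp add: contract_apply)
    qed
    then show ?thesis
      using form_expand[OF Cons.prems(1), of v vs] by (simp add: contract_apply)
  qed
qed

text \<open>More than eight vectors taken from the frame contain a repetition.\<close>

lemma forms_gt_8:
  assumes "\<omega> \<in> forms k" "8 < k"
  shows "\<omega> vs = 0"
proof (rule forms_eq_0_on_frame[OF assms(1)])
  fix "is" :: "nat list" assume *: "length is = k" "set is \<subseteq> {..<8}"
  have "card (set is) \<le> 8" using card_mono[OF _ *(2)] by simp
  then have "card (set is) \<noteq> length is" using * assms(2) by simp
  then have "\<not> distinct (map e is)" by (metis distinct_card distinct_map)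
  then show "\<omega> (map e is) = 0" using assms(1) by (simp add: forms_def)
qed

lemma flat_forms: "flat G u \<in> forms 1"
proof -
  have "flat G u \<in> forms (Suc 0)"
  proof (rule forms_SucI)
    fix vs
    show "linear (\<lambda>v. flat G u (v # vs))"
      using G_lin2[of u] by (cases vs) (simp_all add: flat_def linear_zero)
  qed (auto simp: flat_def forms_0_iff contract_apply)
  then show ?thesis by simp
qed

lemma wedge_flat_forms: "\<omega> \<in> forms k \<Longrightarrow> wedge (flat G u) \<omega> \<in> forms (Suc k)"
  by (rule wedge1_forms[OF flat_forms])

lemma wedge_flat_Cons: "wedge (flat G u) \<omega> (v # vs) = G u v * \<omega> vs - wedge (flat G u) (contract v \<omega>) vs"
  by (simp add: wedge1_Cons[OF flat_forms])

lemma contract_wedge_flat: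
  "contract v (wedge (flat G u) \<omega>) = (\<lambda>vs. G u v * \<omega> vs - wedge (flat G u) (contract v \<omega>) vs)"
  by (auto simp: contract_apply wedge_flat_Cons)

lemma flat_expand: "flat G u = (\<lambda>vs. \<Sum>i<8. G u (e i) * flat G (e i) vs)"
proof
  fix vs
  show "flat G u vs = (\<Sum>i<8. G u (e i) * flat G (e i) vs)"
    using linear_expand_real[OF G_lin1, of u] by (cases vs rule: remdups_adj.cases) (simp_all add: flat_def)
qed

lemma forms1_expand:
  assumes "\<eta> \<in> forms 1"
  shows "\<eta> = flat G (\<Sum>i<8. \<eta> [e i] *\<^sub>R e i)"
proof
  fix vs
  show "\<eta> vs = flat G (\<Sum>i<8. \<eta> [e i] *\<^sub>R e i) vs"
  proof (cases "length vs = 1")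
    case True
    then obtain v where "vs = [v]" by (auto simp: length_Suc_conv)
    then show ?thesis
      using form_expand[OF assms, of v "[]"]
      by (simp only: flat_apply G_sum1 G_simps) (simp add: symm mult.commute)
  qed (simp add: forms_lengthD[OF assms] forms_lengthD[OF flat_forms])
qed

text \<open>Contracting with \<open>e c\<close> and wedging with its dual, summed over the frame,
  counts the degree. Hence every form of positive degree is a combination of products
  \<open>wedge (flat G u) \<beta>\<close>, which allows induction on the degree.\<close>

lemma euler:
  assumes "\<omega> \<in> forms k"
  shows "(\<Sum>c<8. wedge (flat G (e c)) (contract (e c) \<omega>) vs) = k * \<omega> vs"
  using assms
proof (induction vs arbitrary: \<omega> k)
  case Nil
  then show ?case using forms_lengthD[OF Nil, of "[]"] by (cases "k = 0") (simp_all add: flat_def)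
next
  case (Cons v vs)
  have sw: "contract v (contract (e c) \<omega>) = (\<lambda>vs. - contract (e c) (contract v \<omega>) vs)" for c
    using form_swap[OF Cons.prems, of v "e c"] by (simp add: contract_apply fun_eq_iff)
  have "(\<Sum>c<8. wedge (flat G (e c)) (contract (e c) \<omega>) (v # vs)) =
      (\<Sum>c<8. G (e c) v * \<omega> (e c # vs)) + (\<Sum>c<8. wedge (flat G (e c)) (contract (e c) (contract v \<omega>)) vs)"
    unfolding wedge_flat_Cons sw wedge_minus_right by (simp add: sum.distrib contract_apply[of _ \<omega> vs])
  also have "(\<Sum>c<8. G (e c) v * \<omega> (e c # vs)) = \<omega> (v # vs)"
    using form_expand[OF Cons.prems, of v] by (simp add: symm)
  also have "(\<Sum>c<8. wedge (flat G (e c)) (contract (e c) (contract v \<omega>)) vs) = real (k - 1) * contract v \<omega> vs"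
    by (rule Cons.IH[OF contract_forms'[OF Cons.prems]])
  also have "\<omega> (v # vs) + real (k - 1) * contract v \<omega> vs = k * \<omega> (v # vs)"
    using Cons.prems by (cases k) (simp_all add: contract_apply algebra_simps forms_0_iff)
  finally show ?case .
qed

abbreviation "cw \<equiv> coframe_wedge G e"
abbreviation "vol \<equiv> cw [0..<8]"
abbreviation "hdg \<equiv> frame_hodge G e"

lemma cw_forms: "cw is \<in> forms (length is)"
  by (induction "is") (simp_all add: forms_0_iff wedge_flat_forms)

lemma vol_forms: "vol \<in> forms 8"
  using cw_forms[of "[0..<8]"] by simp

lemma cw_diag:
  assumes "distinct is" "set is \<subseteq> {..<8}"
  shows "cw is (map e is) = 1"
  using assms
proof (induction "is")
  case (Cons i "is")
  have "wedge (flat G (e i)) (cw is) ([] @ e i # map e is) = 1"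
    by (subst wedge_forms1_append[OF flat_forms]) (use Cons in \<open>auto simp: G_e\<close>)
  then show ?case by simp
qed simp

text \<open>The sign counts the factors that the contraction has to pass. With this rule the
  simplifier evaluates \<open>phi\<close> and its Hodge star monomial by monomial.\<close>

lemma cw_contract:
  assumes "distinct is" "set is \<subseteq> {..<8}" "j < 8"
  shows "cw is (e j # vs) =
    (if j \<in> set is then (-1) ^ length (takeWhile (\<lambda>i. i \<noteq> j) is) * cw (remove1 j is) vs else 0)"
  using assms
proof (induction "is" arbitrary: vs)
  case (Cons i "is")
  then have IH: "contract (e j) (cw is) =
    (\<lambda>vs. if j \<in> set is then (-1) ^ length (takeWhile (\<lambda>i. i \<noteq> j) is) * cw (remove1 j is) vs else 0)"
    by (auto simp: contract_apply)
  show ?case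
    using Cons.prems unfolding coframe_wedge.simps wedge_flat_Cons IH
    by (auto simp: G_e wedge_linear)
qed simp

lemma hdg_forms:
  assumes "\<omega> \<in> forms k"
  shows "hdg \<omega> \<in> forms (8 - k)"
  unfolding frame_hodge_def
proof (rule forms_sum)
  fix I :: "nat set" assume I: "I \<in> Pow {..<8}"
  let ?l = "map e (sorted_list_of_set I)"
  show "(\<lambda>vs. \<omega> ?l * vol (?l @ vs)) \<in> forms (8 - k)"
  proof (cases "card I = k")
    case True
    then show ?thesis using forms_scale[OF forms_append[OF vol_forms, of ?l], of "\<omega> ?l"] by simp
  next
    case False
    then have "\<omega> ?l = 0" using assms by (simp add: forms_lengthD)
    then show ?thesis by simp
  qed
qed

lemma hdg_add: "hdg (\<lambda>vs. \<alpha> vs + \<beta> vs) vs = hdg \<alpha> vs + hdg \<beta> vs"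
  by (simp add: frame_hodge_def algebra_simps sum.distrib)

lemma hdg_scale: "hdg (\<lambda>vs. c * \<alpha> vs) vs = c * hdg \<alpha> vs"
  by (simp add: frame_hodge_def algebra_simps sum_distrib_left)

lemma hdg_minus: "hdg (\<lambda>vs. - \<alpha> vs) vs = - hdg \<alpha> vs"
  using hdg_scale[of "-1"] by simp

lemma hdg_diff: "hdg (\<lambda>vs. \<alpha> vs - \<beta> vs) vs = hdg \<alpha> vs - hdg \<beta> vs"
  using hdg_add[of \<alpha> "\<lambda>vs. - \<beta> vs"] by (simp add: hdg_minus)

lemma hdg_0 [simp]: "hdg (\<lambda>_. 0) vs = 0"
  by (simp add: frame_hodge_def)

lemma hdg_sum: "hdg (\<lambda>vs. \<Sum>i\<in>I. \<alpha> i vs) vs = (\<Sum>i\<in>I. hdg (\<alpha> i) vs)"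
  by (induction I rule: infinite_finite_induct) (simp_all add: hdg_add)

lemmas hdg_linear = hdg_add hdg_scale hdg_minus hdg_diff hdg_sum

text \<open>The index sets in the definition of the star are paired as \<open>I\<close> and
  \<open>insert j I\<close> with \<open>j\<close> outside \<open>I\<close>. In each pair only one
  summand survives on either side, and the two survivors agree up to the sign.\<close>

lemma hdg_wedge_frame:
  assumes "\<omega> \<in> forms k" "j < 8"
  shows "hdg (wedge (flat G (e j)) \<omega>) vs = (-1) ^ k * hdg \<omega> (e j # vs)"
proof -
  define A where "A = {..<8} - {j}"
  define l where "l I = map e (sorted_list_of_set I)" for I
  have P: "Pow {..<8} = Pow A \<union> insert j ` Pow A"
    using assms(2) Pow_insert[of j A] by (simp add: A_def insert_absorb)
  have split: "(\<Sum>I\<in>Pow {..<8}. f I) = (\<Sum>I\<in>Pow A. f I + f (insert j I))" for f :: "_ \<Rightarrow> real"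
  proof -
    have "(\<Sum>I\<in>Pow {..<8}. f I) = sum f (Pow A) + sum f (insert j ` Pow A)"
      unfolding P by (rule sum.union_disjoint) (auto simp: A_def)
    also have "sum f (insert j ` Pow A) = (\<Sum>I\<in>Pow A. f (insert j I))"
      by (subst sum.reindex) (auto simp: inj_on_def A_def)
    finally show ?thesis by (simp add: sum.distrib)
  qed
  have main: "wedge (flat G (e j)) \<omega> (l I) * vol (l I @ vs) +
      wedge (flat G (e j)) \<omega> (l (insert j I)) * vol (l (insert j I) @ vs) =
      (-1) ^ k * (\<omega> (l I) * vol (l I @ e j # vs)
        + \<omega> (l (insert j I)) * vol (l (insert j I) @ e j # vs))" if I: "I \<in> Pow A" for I
  proof -
    have fin: "finite I" and jI: "j \<notin> I" using I by (auto simp: A_def intro: finite_subset)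
    \<comment> \<open>Inserting \<open>j\<close> splits the sorted list at one place. The length of
      \<open>xs\<close> gives a sign both in the wedge product and in the volume form, so it
      cancels.\<close>
    obtain xs ys where 1: "sorted_list_of_set I = xs @ ys"
      and 2: "sorted_list_of_set (insert j I) = xs @ j # ys"
      using insort_split[of "sorted_list_of_set I" j] fin jI by auto
    have s: "set xs \<union> set ys = I" using 1 fin by (metis set_append set_sorted_list_of_set)
    have "\<forall>i\<in>set xs \<union> set ys. i < 8 \<and> i \<noteq> j"
      using s I by (auto simp: A_def)
    then have z: "\<forall>u\<in>set (map e xs) \<union> set (map e ys). flat G (e j) [u] = 0"
      using assms(2) by (auto simp: G_e)
    have l1: "l I = map e xs @ map e ys" and l2: "l (insert j I) = map e xs @ e j # map e ys"
      by (simp_all add: l_def 1 2)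
    have a: "wedge (flat G (e j)) \<omega> (l I) = 0"
      by (rule wedge_forms1_zero[OF flat_forms]) (use z in \<open>auto simp: l1\<close>)
    have b: "wedge (flat G (e j)) \<omega> (l (insert j I)) = (-1) ^ length xs * \<omega> (l I)"
      unfolding l1 l2 by (subst wedge_forms1_append[OF flat_forms]) (use z assms in \<open>auto simp: G_e\<close>)
    have c: "vol (l (insert j I) @ e j # vs) = 0"
      using vol_forms by (simp add: forms_def l2)
    have d: "vol (l (insert j I) @ vs) = (-1) ^ length xs * vol (e j # l I @ vs)"
      using form_move[OF vol_forms, of "map e xs"] by (simp add: l1 l2)
    have f: "vol (l I @ e j # vs) = (-1) ^ length (l I) * vol (e j # l I @ vs)"
      by (rule form_move[OF vol_forms])
    \<comment> \<open>Moving \<open>e j\<close> past \<open>l I\<close> costs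
      \<open>(-1) ^ k\<close> wherever it counts: for any other length \<open>\<omega>\<close>
      vanishes on \<open>l I\<close>.\<close>
    have g: "(-1) ^ k * (-1) ^ length (l I) * \<omega> (l I) = \<omega> (l I)"
      using assms(1) by (cases "length (l I) = k") (simp_all add: forms_lengthD flip: power_mult_distrib)
    show ?thesis
      unfolding a b c d f using g
      by (simp add: mult.assoc[symmetric] flip: power_mult_distrib)
  qed
  show ?thesis
    unfolding frame_hodge_def split sum_distrib_left l_def[symmetric]
    by (intro sum.cong refl main)
qed

lemma hdg_wedge:
  assumes "\<omega> \<in> forms k"
  shows "hdg (wedge (flat G u) \<omega>) vs = (-1) ^ k * hdg \<omega> (u # vs)"
proof -
  have "hdg (wedge (flat G u) \<omega>) vs = (\<Sum>i<8. G u (e i) * hdg (wedge (flat G (e i)) \<omega>) vs)"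
    by (subst flat_expand) (simp only: wedge_fun_linear hdg_linear)
  also have "\<dots> = (-1) ^ k * (\<Sum>i<8. G u (e i) * hdg \<omega> (e i # vs))"
    by (simp add: hdg_wedge_frame[OF assms] sum_distrib_left algebra_simps)
  finally show ?thesis by (simp add: form_expand[OF hdg_forms[OF assms]])
qed

lemma hdg_0_form: "\<omega> \<in> forms 0 \<Longrightarrow> hdg \<omega> vs = \<omega> [] * vol vs"
proof -
  assume *: "\<omega> \<in> forms 0"
  have "hdg \<omega> vs = (\<Sum>I\<in>Pow {..<8::nat}. if I = {} then \<omega> [] * vol vs else 0)"
    unfolding frame_hodge_def
  proof (intro sum.cong refl)
    fix I :: "nat set" assume "I \<in> Pow {..<8}"
    then have "finite I" by (auto intro: finite_subset)
    then show "\<omega> (map e (sorted_list_of_set I)) * vol (map e (sorted_list_of_set I) @ vs) =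
      (if I = {} then \<omega> [] * vol vs else 0)"
      using * by (auto simp: forms_lengthD)
  qed
  then show ?thesis by simp
qed

text \<open>The star exchanges contraction and wedge product. Induction on the degree: by
  \<open>euler\<close> it is enough to treat \<open>wedge (flat G u) \<beta>\<close>, where
  \<open>hdg_wedge\<close> leads back to the claim for \<open>\<beta>\<close>.\<close>

lemma hdg_contract:
  assumes "\<omega> \<in> forms k"
  shows "hdg (contract v \<omega>) vs = - ((-1) ^ k) * wedge (flat G v) (hdg \<omega>) vs"
  using assms
proof (induction k arbitrary: \<omega> vs)
  case 0
  have "wedge (flat G v) vol vs = 0"
    using forms_gt_8[OF wedge_flat_forms[OF vol_forms]] by simp
  moreover have "hdg \<omega> = (\<lambda>vs. \<omega> [] * vol vs)" using hdg_0_form[OF 0] by auto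
  ultimately show ?case by (simp add: contract_forms_0[OF 0] wedge_linear)
next
  case (Suc k)
  have *: "hdg (contract v (wedge (flat G u) \<beta>)) vs =
      (-1) ^ k * wedge (flat G v) (hdg (wedge (flat G u) \<beta>)) vs" if "\<beta> \<in> forms k" for u \<beta>
  proof -
    have "hdg (contract v (wedge (flat G u) \<beta>)) vs
        = G u v * hdg \<beta> vs - hdg (wedge (flat G u) (contract v \<beta>)) vs"
      by (simp add: contract_wedge_flat hdg_linear)
    also have "hdg (wedge (flat G u) (contract v \<beta>)) vs = - ((-1) ^ k) * hdg (contract v \<beta>) (u # vs)"
      using that by (cases k) (simp_all add: contract_forms_0 wedge_fun_linear hdg_wedge[OF contract_forms])
    also have "hdg (contract v \<beta>) (u # vs) = - ((-1) ^ k) * wedge (flat G v) (hdg \<beta>) (u # vs)"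
      by (rule Suc.IH[OF that])
    also have "wedge (flat G v) (hdg \<beta>) (u # vs) =
        G v u * hdg \<beta> vs - wedge (flat G v) (contract u (hdg \<beta>)) vs"
      by (rule wedge_flat_Cons)
    also have "contract u (hdg \<beta>) = (\<lambda>vs. (-1) ^ k * hdg (wedge (flat G u) \<beta>) vs)"
      by (auto simp: contract_apply hdg_wedge[OF that] simp flip: power_mult_distrib)
    finally show ?thesis
      by (simp add: wedge_linear symm[of u v] flip: power_mult_distrib mult.assoc)
  qed
  have eu: "\<omega> = (\<lambda>vs. (1 / Suc k) * (\<Sum>c<8. wedge (flat G (e c)) (contract (e c) \<omega>) vs))"
    using euler[OF Suc.prems] by (auto simp: fun_eq_iff)
  have ceu: "contract v \<omega> = (\<lambda>vs. (1 / Suc k) * (\<Sum>c<8. contract v (wedge (flat G (e c)) (contract (e c) \<omega>)) vs))"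
    by (subst eu) (auto simp: contract_apply)
  have "hdg (contract v \<omega>) vs =
      (1 / Suc k) * (\<Sum>c<8. hdg (contract v (wedge (flat G (e c)) (contract (e c) \<omega>))) vs)"
    by (subst ceu) (simp only: hdg_linear)
  also have "\<dots> = (-1) ^ k * ((1 / Suc k) * (\<Sum>c<8. wedge (flat G v) (hdg (wedge (flat G (e c)) (contract (e c) \<omega>))) vs))"
    unfolding *[OF contract_forms[OF Suc.prems]] by (simp add: sum_distrib_left)
  also have "(1 / Suc k) * (\<Sum>c<8. wedge (flat G v) (hdg (wedge (flat G (e c)) (contract (e c) \<omega>))) vs) =
      wedge (flat G v) (\<lambda>vs. (1 / Suc k) * (\<Sum>c<8. hdg (wedge (flat G (e c)) (contract (e c) \<omega>)) vs)) vs"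
    by (simp only: wedge_linear)
  also have "(\<lambda>vs. (1 / Suc k) * (\<Sum>c<8. hdg (wedge (flat G (e c)) (contract (e c) \<omega>)) vs)) = hdg \<omega>"
    using fun_cong[OF arg_cong[OF eu, of hdg]] by (intro ext) (simp only: hdg_linear)
  finally show ?case by simp
qed

text \<open>Injectivity of the star. By \<open>hdg_contract\<close> its kernel is closed under
  contraction, which leads down to 0-forms; these become multiples of \<open>vol\<close>, and
  \<open>vol\<close> is 1 on the frame.\<close>

lemma hdg_eq_0:
  assumes "\<omega> \<in> forms k" "\<And>vs. hdg \<omega> vs = 0"
  shows "\<omega> vs = 0"
  using assms
proof (induction vs arbitrary: k \<omega>)
  case Nil
  show ?case
  proof (cases k)
    case 0
    moreover have "vol (map e [0..<8]) = 1" by (rule cw_diag) auto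
    ultimately show ?thesis
      using Nil hdg_0_form[of \<omega> "map e [0..<8]"] by simp
  qed (use Nil in \<open>simp add: forms_lengthD\<close>)
next
  case (Cons v vs)
  have h: "hdg \<omega> = (\<lambda>_. 0)" using Cons.prems by auto
  have "hdg (contract v \<omega>) vs = 0" for vs
    by (simp add: hdg_contract[OF Cons.prems(1)] h)
  from Cons.IH[OF contract_forms'[OF Cons.prems(1)] this] show ?case by (simp add: contract_apply)
qed

end


section \<open>The complex structures spanning \<open>\<Lambda>\<^sup>2\<^sub>7\<close>\<close>

lemma less_8_cases:
  fixes i :: nat
  shows "i < 8 \<Longrightarrow> i = 0 \<or> i = 1 \<or> i = 2 \<or> i = 3 \<or> i = 4 \<or> i = 5 \<or> i = 6 \<or> i = 7"
  by presburger

lemma all_less_8: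
  "(\<forall>i<8::nat. P i) \<longleftrightarrow> P 0 \<and> P 1 \<and> P 2 \<and> P 3 \<and> P 4 \<and> P 5 \<and> P 6 \<and> P 7"
  by (auto dest!: less_8_cases)

lemma sum_less_8:
  fixes f :: "nat \<Rightarrow> 'b::comm_monoid_add"
  shows "(\<Sum>i<8. f i) = f 0 + f 1 + f 2 + f 3 + f 4 + f 5 + f 6 + f 7"
  by (simp add: eval_nat_numeral)

lemma sum_1_7:
  fixes f :: "nat \<Rightarrow> 'b::comm_monoid_add"
  shows "(\<Sum>i=1..7. f i) = f 1 + f 2 + f 3 + f 4 + f 5 + f 6 + f 7"
  by (simp add: eval_nat_numeral)

text \<open>The entry \<open>(p, s)\<close> in row \<open>i\<close> and column \<open>a\<close> encodes \<open>J\<^sub>i e\<^sub>a = s e\<^sub>p\<close>, where the 2-form of \<open>J\<^sub>i\<close> is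
  \<open>4 (e\<^sup>0 \<and> e\<^sup>i)\<^sub>7\<close>. Row \<open>0\<close> is a dummy.\<close>

definition J_table :: "(nat \<times> real) list list" where
  "J_table = [[],
    [(1, 1), (0, -1), (3, 1), (2, -1), (5, -1), (4, 1), (7, -1), (6, 1)],
    [(2, 1), (3, -1), (0, -1), (1, 1), (6, -1), (7, 1), (4, 1), (5, -1)],
    [(3, 1), (2, 1), (1, -1), (0, -1), (7, -1), (6, -1), (5, 1), (4, 1)],
    [(4, 1), (5, 1), (6, 1), (7, 1), (0, -1), (1, -1), (2, -1), (3, -1)],
    [(5, 1), (4, -1), (7, -1), (6, 1), (1, 1), (0, -1), (3, -1), (2, 1)],
    [(6, 1), (7, 1), (4, -1), (5, -1), (2, 1), (3, 1), (0, -1), (1, -1)],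
    [(7, 1), (6, -1), (5, 1), (4, -1), (3, 1), (2, -1), (1, 1), (0, -1)]]"

context frame8
begin

abbreviation "phi \<equiv> spin7_form G e"

lemma phi_forms: "phi \<in> forms 4"
proof -
  have "cw [a, b, c, d] \<in> forms 4" for a b c d using cw_forms[of "[a, b, c, d]"]
    by (simp add: numeral_eq_Suc del: coframe_wedge.simps)
  then show ?thesis
    unfolding spin7_form_def Let_def by (intro forms_add forms_diff)
qed

text \<open>Peeling the factors off by \<open>hdg_wedge\<close> reverses their order; the four signs
  multiply to 1.\<close>

lemma hdg_cw:
  "hdg (cw [a, b, c, d]) vs = vol (e d # e c # e b # e a # vs)"
proof -
  have 0: "hdg (cw []) vs = vol vs" for vs
    using hdg_0_form[of "cw []"] cw_forms[of "[]"] by simp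
  have 1: "hdg (cw (i # is)) vs = (-1) ^ length is * hdg (cw is) (e i # vs)" for i "is" vs
    using hdg_wedge[OF cw_forms] by simp
  show ?thesis by (simp add: 0 1 del: coframe_wedge.simps)
qed

text \<open>The fourteen monomials form seven pairs with complementary index sets, which the star
  exchanges with matching signs.\<close>

lemma hdg_phi: "hdg phi vs = phi vs"
proof -
  have v: "[0..<8] = [0, 1, 2, 3, 4, 5, 6, 7]" by (simp add: upt_rec)
  show ?thesis
    unfolding spin7_form_def Let_def hdg_linear hdg_cw v
    by (simp add: cw_contract del: coframe_wedge.simps)
qed

definition J :: "nat \<Rightarrow> real^8 \<Rightarrow> real^8" where
  "J i v = (\<Sum>a<8. (G v (e a) * snd (J_table ! i ! a)) *\<^sub>R e (fst (J_table ! i ! a)))"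

lemma J_linear: "linear (J i)"
  unfolding J_def
  by (rule linearI) (simp_all add: G_simps distrib_right scaleR_left_distrib sum.distrib scaleR_sum_right mult.assoc)

lemma J_frame: "a < 8 \<Longrightarrow> J i (e a) = snd (J_table ! i ! a) *\<^sub>R e (fst (J_table ! i ! a))"
proof -
  assume a: "a < 8"
  have "J i (e a) = (\<Sum>b<8. if b = a then snd (J_table ! i ! b) *\<^sub>R e (fst (J_table ! i ! b)) else 0)"
    unfolding J_def using a by (intro sum.cong) (auto simp: G_e)
  then show ?thesis using a by simp
qed

lemma J_simps:
  "J i (u + v) = J i u + J i v" "J i (u - v) = J i u - J i v"
  "J i (c *\<^sub>R u) = c *\<^sub>R J i u" "J i (- u) = - J i u" "J i 0 = 0"
  using linear_add[OF J_linear] linear_diff[OF J_linear] linear_scale[OF J_linear]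
    linear_neg[OF J_linear] linear_0[OF J_linear] by simp_all

lemma J_sum: "J i (sum f A) = (\<Sum>k\<in>A. J i (f k))"
  by (rule linear_sum[OF J_linear])

text \<open>A finite check on the table, phrased with bounded quantifiers so that
  \<open>all_less_8\<close> unfolds it into its cases.\<close>

lemma clifford_frame:
  "\<forall>i<8. \<forall>j<8. \<forall>a<8. i \<ge> 1 \<longrightarrow> j \<ge> 1 \<longrightarrow>
     J i (J j (e a)) + J j (J i (e a)) = (if i = j then -2 else 0) *\<^sub>R e a"
  unfolding all_less_8
  by (simp add: J_frame J_simps J_table_def) (simp only: mult_2 scaleR_2 simp_thms)

lemma skew_frame: "\<forall>i<8. \<forall>a<8. \<forall>b<8. i \<ge> 1 \<longrightarrow> G (J i (e a)) (e b) = - G (e a) (J i (e b))"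
  unfolding all_less_8
  by (simp add: J_frame G_simps G_e J_table_def)

lemma clifford:
  assumes "i \<in> {1..7}" "j \<in> {1..7}"
  shows "J i (J j v) + J j (J i v) = (if i = j then -2 else 0) *\<^sub>R v"
proof (rule linear_eq_on_frame[where v=v])
  show "linear (\<lambda>v. J i (J j v) + J j (J i v))"
    by (rule linearI) (simp_all add: J_simps algebra_simps)
  show "linear (\<lambda>v. (if i = j then -2 else 0) *\<^sub>R v :: real^8)"
    by (rule linearI) (simp_all add: algebra_simps)
  show "J i (J j (e a)) + J j (J i (e a)) = (if i = j then -2 else 0) *\<^sub>R e a" if "a < 8" for a
    using clifford_frame assms that by auto
qed

lemma J_skew:
  assumes "i \<in> {1..7}"
  shows "G (J i u) v = - G u (J i v)"
proof -
  have l: "linear (\<lambda>v. - G u (J i v))" "linear (\<lambda>v. G (J i v) u)" "linear (\<lambda>v. - G v u)" for u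
    by (rule linearI; simp add: J_simps G_simps)+
  have "G (J i (e a)) v = - G (e a) (J i v)" if "a < 8" for a
  proof (rule linear_eq_on_frame[OF G_lin2 l(1)])
    show "G (J i (e a)) (e b) = - G (e a) (J i (e b))" if "b < 8" for b
      using skew_frame assms \<open>a < 8\<close> that by simp
  qed
  then show ?thesis
    by (rule linear_eq_on_frame[OF l(2) l(3)])
qed

lemma J_sq: "i \<in> {1..7} \<Longrightarrow> J i (J i v) = - v"
  using clifford[of i i v] by (simp flip: scaleR_2) (metis scaleR_cancel_left scaleR_minus_right zero_neq_numeral)

text \<open>Only the 28 pairs with \<open>m < n\<close> carry content, while \<open>c\<close> and
  \<open>d\<close> stay arbitrary: each case is a polynomial identity in the values of the coframe
  on \<open>c\<close> and \<open>d\<close>.\<close>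

lemma phi_J_frame:
  "\<forall>m<8. \<forall>n<8. m < n \<longrightarrow> phi [e m, e n, c, d] =
     (\<Sum>i=1..7. G (J i (e m)) (e n) * G (J i c) d) - G (e m) c * G (e n) d + G (e m) d * G (e n) c"
proof -
  have cw2: "cw [p, q] [c, d] = G (e p) c * G (e q) d - G (e q) c * G (e p) d" for p q
    by (simp add: wedge_flat_Cons contract_apply)
  have Gc: "G (J i c) d = (\<Sum>a<8. snd (J_table ! i ! a) * (G (e a) c * G (e (fst (J_table ! i ! a))) d))" for i
    unfolding J_def G_sum1 G_simps by (simp add: symm mult.commute mult.left_commute)
  show ?thesis
    unfolding all_less_8 sum_1_7
    by (simp add: spin7_form_def cw_contract cw2 J_frame del: coframe_wedge.simps)
      (simp add: J_table_def G_simps G_e Gc sum_less_8)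
qed

text \<open>Viewed as operators on 2-forms, the last two terms are minus the identity, and the sum
  over \<open>i\<close> is four times the projection onto the span of the \<open>J i\<close>: the
  eigenvalues are 3 and -1. The proof extends \<open>phi_J_frame\<close> by antisymmetry in
  \<open>a\<close> and \<open>b\<close> and by bilinearity.\<close>

lemma phi_J:
  "phi [a, b, c, d] = (\<Sum>i=1..7. G (J i a) b * G (J i c) d) - G a c * G b d + G a d * G b c"
    (is "_ = ?R a b")
proof -
  note l = J_simps G_simps algebra_simps sum.distrib sum_distrib_left
  have skew: "?R v u = - ?R u v" for u v
  proof -
    have "(\<Sum>i=1..7. G (J i v) u * G (J i c) d) = - (\<Sum>i=1..7. G (J i u) v * G (J i c) d)"
      unfolding sum_negf[symmetric] by (intro sum.cong refl) (simp add: J_skew[of _ v u] symm[of v])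
    then show ?thesis by simp
  qed
  have "phi [e m, e n, c, d] = ?R (e m) (e n)" if "m < 8" "n < 8" for m n
  proof (cases m n rule: linorder_cases)
    case less
    then show ?thesis using phi_J_frame that by blast
  next
    case equal
    then show ?thesis using skew[of "e n" "e n"] phi_forms by (simp add: forms_def)
  next
    case greater
    then show ?thesis
      using phi_J_frame that form_swap[OF phi_forms, of "e m" "e n" "[c, d]"] skew[of "e m" "e n"] by simp
  qed
  moreover have "linear (\<lambda>b. phi [a, b, c, d])" for a
    using forms_linear[OF phi_forms, of "[a]"] by simp
  moreover have "linear (\<lambda>b. ?R a b)" for a by (rule linearI) (simp_all add: l)
  ultimately have "phi [e m, b, c, d] = ?R (e m) b" if "m < 8" for m b
    using that linear_eq_on_frame[of "\<lambda>b. phi [e m, b, c, d]" "?R (e m)" b] by blast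
  moreover have "linear (\<lambda>a. phi [a, b, c, d])"
    using forms_linear_Cons[OF phi_forms] .
  moreover have "linear (\<lambda>a. ?R a b)" by (rule linearI) (simp_all add: l)
  ultimately show ?thesis
    using linear_eq_on_frame[of "\<lambda>a. phi [a, b, c, d]" "\<lambda>a. ?R a b" a] by blast
qed

end

section \<open>Projection to \<open>\<Lambda>\<^sup>2\<^sub>7\<close> and commutators with the
  complex structures\<close>

context frame8
begin

lemma G_eqI': "(\<And>d. G u d = G v d) \<Longrightarrow> u = v"
  by (rule G_eqI) simp

lemma trace_cyclic:
  assumes "linear A" "linear C"
  shows "(\<Sum>m<8. G (A (C (e m))) (e m)) = (\<Sum>m<8. G (C (A (e m))) (e m))"
proof -
  have *: "G (A (C (e m))) (e m) = (\<Sum>n<8. G (C (e m)) (e n) * G (A (e n)) (e m))"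
    if "linear A" for A C m
  proof -
    have "linear (\<lambda>v. G (A v) (e m))"
      using linear_compose[OF that G_lin1] by (simp add: o_def)
    from linear_expand_real[OF this] show ?thesis by simp
  qed
  show ?thesis
    unfolding *[OF assms(1)] *[OF assms(2)] by (subst sum.swap) (simp add: mult.commute)
qed

text \<open>For skew \<open>B\<close>, the inner product of the 2-forms of \<open>J i\<close> and
  \<open>B\<close>; the factor 1/2 compensates for counting each pair of indices twice.\<close>

definition endo_coeff7 :: "nat \<Rightarrow> (real^8 \<Rightarrow> real^8) \<Rightarrow> real" where
  "endo_coeff7 i B = 1/2 * (\<Sum>m<8. G (J i (e m)) (B (e m)))"

definition skew :: "(real^8 \<Rightarrow> real^8) \<Rightarrow> bool" where
  "skew B \<longleftrightarrow> linear B \<and> (\<forall>u v. G (B u) v = - G u (B v))"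

text \<open>The orthogonal projection of a skew \<open>B\<close>. The coefficients are divided by 4
  because the 2-form of \<open>J i\<close> has squared norm 4, see
  \<open>endo_coeff7_J\<close>.\<close>

definition part7 :: "(real^8 \<Rightarrow> real^8) \<Rightarrow> real^8 \<Rightarrow> real^8" where
  "part7 B v = (\<Sum>i=1..7. (endo_coeff7 i B / 4) *\<^sub>R J i v)"

text \<open>The same coefficient read off a 2-form; \<open>form_coeff7_endo_form\<close> relates it
  to \<open>endo_coeff7\<close>.\<close>

definition form_coeff7 :: "nat \<Rightarrow> form \<Rightarrow> real" where
  "form_coeff7 i \<omega> = 1/2 * (\<Sum>c<8. \<omega> [e c, J i (e c)])"

lemma skewD: "skew B \<Longrightarrow> G (B u) v = - G u (B v)"
  by (simp add: skew_def)

lemma skew_diag: "skew B \<Longrightarrow> G (B u) u = 0"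
  using skewD[of B u u] symm[of u] by simp

lemma skew_lin:
  assumes "skew B"
  shows "B (u + v) = B u + B v" "B (u - v) = B u - B v" "B (c *\<^sub>R u) = c *\<^sub>R B u"
    "B (- u) = - B u" "B (sum f A) = (\<Sum>i\<in>A. B (f i))"
proof -
  have l: "linear B" using assms by (simp add: skew_def)
  show "B (u + v) = B u + B v" "B (u - v) = B u - B v" "B (c *\<^sub>R u) = c *\<^sub>R B u"
    "B (- u) = - B u" "B (sum f A) = (\<Sum>i\<in>A. B (f i))"
    using linear_add[OF l] linear_diff[OF l] linear_scale[OF l] linear_neg[OF l] linear_sum[OF l] by simp_all
qed

text \<open>Twice each summand is minus the anticommutator of \<open>J i\<close> and
  \<open>J j\<close> tested on one vector, so the Clifford relations apply.\<close>

lemma endo_coeff7_J: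
  assumes "i \<in> {1..7}" "j \<in> {1..7}"
  shows "endo_coeff7 i (J j) = (if i = j then 4 else 0)"
proof -
  have 1: "G (J i u) (J j u) = - G u (J i (J j u))" for u using J_skew[OF assms(1)] .
  have 2: "G (J i u) (J j u) = - G u (J j (J i u))" for u
    using J_skew[OF assms(2), of u "J i u"] symm[of "J j u" "J i u"] by simp
  have "2 * G (J i u) (J j u) = - G u (J i (J j u) + J j (J i u))" for u
    using 1[of u] 2[of u] by (simp add: G_simps)
  then have *: "2 * G (J i u) (J j u) = (if i = j then 2 * G u u else 0)" for u
    by (simp add: clifford[OF assms] G_simps)
  have "G (J i (e m)) (J j (e m)) = (if i = j then 1 else 0)" if "m < 8" for m
    using *[of "e m"] that by (auto simp: G_e split: if_splits)
  then show ?thesis by (simp add: endo_coeff7_def)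
qed

lemma phi_swap13: "phi [a, b, c, d] = - phi [c, b, a, d]"
  using form_swap[OF phi_forms, of a b "[c, d]"] form_swap[OF phi_forms, of b c "[a, d]"]
    form_swap[OF contract_forms'[OF phi_forms, of b], of a c "[d]"]
  by (simp add: contract_apply)

lemma fierz:
  assumes "skew B"
  shows "(\<Sum>i=1..7. J i (B (J i c))) = 8 *\<^sub>R part7 B c - 3 *\<^sub>R B c"
proof (rule G_eqI')
  fix d
  note lB = skew_lin[OF assms]
  \<comment> \<open>Antisymmetry of \<open>phi\<close> in its first and third arguments, traced
    against \<open>B\<close>. Expanded by \<open>phi_J\<close>, the first term produces the
    projection of \<open>B\<close> and the second the sum of the
    \<open>J i (B (J i c))\<close>.\<close>
  have "0 = (\<Sum>m<8. phi [e m, B (e m), c, d] + phi [c, B (e m), e m, d])"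
    using phi_swap13[of "e _" _ c d] by simp
  also have "\<dots> = (\<Sum>m<8. \<Sum>i=1..7. G (J i (e m)) (B (e m)) * G (J i c) d)
      - (\<Sum>m<8. G (e m) c * G (B (e m)) d) + (\<Sum>m<8. G (e m) d * G (B (e m)) c)
      + (\<Sum>m<8. \<Sum>i=1..7. G (J i c) (B (e m)) * G (J i (e m)) d)
      - (\<Sum>m<8. G (e m) c * G (B (e m)) d) + (\<Sum>m<8. G c d * G (B (e m)) (e m))"
    unfolding phi_J by (simp add: sum.distrib sum_subtractf symm[of c "e _"] flip: sum_distrib_left)
  also have "(\<Sum>m<8. \<Sum>i=1..7. G (J i (e m)) (B (e m)) * G (J i c) d) = (\<Sum>i=1..7. 2 * endo_coeff7 i B * G (J i c) d)"
    by (subst sum.swap) (simp add: endo_coeff7_def sum_distrib_right)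
  also have "(\<Sum>m<8. G (e m) c * G (B (e m)) d) = G (B c) d"
    by (rule linear_expand_real') (auto intro!: linearI simp: lB G_simps)
  also have "(\<Sum>m<8. G (e m) d * G (B (e m)) c) = G (B d) c"
    by (rule linear_expand_real') (auto intro!: linearI simp: lB G_simps)
  also have "(\<Sum>m<8. \<Sum>i=1..7. G (J i c) (B (e m)) * G (J i (e m)) d) = (\<Sum>i=1..7. - G (J i (B (J i c))) d)"
  proof (subst sum.swap, rule sum.cong[OF refl])
    fix i :: nat assume i: "i \<in> {1..7}"
    have "(\<Sum>m<8. G (J i c) (B (e m)) * G (J i (e m)) d) = (\<Sum>m<8. G (B (J i c)) (e m) * G (J i d) (e m))"
      using skewD[OF assms, of "J i c"] J_skew[OF i] by (simp add: symm[of "e _"])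
    also have "\<dots> = G (B (J i c)) (J i d)" by (rule parseval)
    finally show "(\<Sum>m<8. G (J i c) (B (e m)) * G (J i (e m)) d) = - G (J i (B (J i c))) d"
      by (simp add: J_skew[OF i])
  qed
  also have "G (B d) c = - G (B c) d" using skewD[OF assms, of d c] symm[of d] by simp
  finally show "G (\<Sum>i=1..7. J i (B (J i c))) d = G (8 *\<^sub>R part7 B c - 3 *\<^sub>R B c) d"
    by (simp add: skew_diag[OF assms] sum_negf G_sum1 G_simps part7_def sum_distrib_left mult.assoc)
qed

lemma part7_lin: "part7 B (u + v) = part7 B u + part7 B v" "part7 B (u - v) = part7 B u - part7 B v"
    "part7 B (c *\<^sub>R u) = c *\<^sub>R part7 B u" "part7 B (- u) = - part7 B u"
  by (simp_all add: part7_def J_simps sum.distrib scaleR_add_right scaleR_diff_right sum_subtractf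
      scaleR_sum_right sum_negf mult.commute)

text \<open>\<open>part7 B\<close> is a combination of Clifford generators, so its anticommutator
  with \<open>J i\<close> is a scalar, which recovers the coefficient along
  \<open>J i\<close>.\<close>

lemma J_part7:
  assumes "i \<in> {1..7}"
  shows "J i (part7 B v) + part7 B (J i v) = - (endo_coeff7 i B / 2) *\<^sub>R v"
proof -
  have "J i (part7 B v) + part7 B (J i v) = (\<Sum>j=1..7. (endo_coeff7 j B / 4) *\<^sub>R (J i (J j v) + J j (J i v)))"
    by (simp add: part7_def J_sum J_simps scaleR_add_right sum.distrib)
  also have "\<dots> = (\<Sum>j=1..7. if j = i then - (endo_coeff7 i B / 2) *\<^sub>R v else 0)"
    using assms by (intro sum.cong) (auto simp: clifford)
  finally show ?thesis using assms by simp
qed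

text \<open>For \<open>A\<close> in the span of the \<open>J i\<close>, each
  \<open>J i A J i\<close> is \<open>A\<close> minus twice the component of \<open>A\<close> along
  \<open>J i\<close>; seven times \<open>A\<close> minus twice \<open>A\<close> remains.\<close>

lemma sum_J_part7_J: "(\<Sum>i=1..7. J i (part7 B (J i v))) = 5 *\<^sub>R part7 B v"
proof -
  have "J i (part7 B (J i v)) = part7 B v - 2 *\<^sub>R ((endo_coeff7 i B / 4) *\<^sub>R J i v)" if "i \<in> {1..7}" for i
  proof -
    have "part7 B (J i v) = (J i (part7 B v) + part7 B (J i v)) - J i (part7 B v)" by simp
    then have "part7 B (J i v) = - (endo_coeff7 i B / 2) *\<^sub>R v - J i (part7 B v)"
      unfolding J_part7[OF that] .
    then show ?thesis by (simp add: J_simps J_sq[OF that])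
  qed
  then have "(\<Sum>i=1..7. J i (part7 B (J i v))) = (\<Sum>i=1..7. part7 B v - 2 *\<^sub>R ((endo_coeff7 i B / 4) *\<^sub>R J i v))"
    by (rule sum.cong[OF refl])
  also have "\<dots> = 7 *\<^sub>R part7 B v - 2 *\<^sub>R part7 B v"
    unfolding sum_subtractf scaleR_sum_right[symmetric] part7_def[symmetric]
    by (simp add: sum_constant_scaleR del: sum_constant)
  finally show ?thesis by (simp flip: scaleR_diff_left)
qed

definition comm :: "nat \<Rightarrow> (real^8 \<Rightarrow> real^8) \<Rightarrow> real^8 \<Rightarrow> real^8" where
  "comm i B v = J i (B v) - B (J i v)"

lemma skew_comm:
  assumes "i \<in> {1..7}" "skew B"
  shows "skew (comm i B)"
  unfolding skew_def
proof (intro conjI allI)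
  show "linear (comm i B)"
    by (rule linearI) (simp_all add: comm_def J_simps skew_lin[OF assms(2)] algebra_simps)
  show "G (comm i B u) v = - G u (comm i B v)" for u v
    by (simp add: comm_def G_simps J_skew[OF assms(1)] skewD[OF assms(2)])
qed

text \<open>The component of \<open>[J\<^sub>i, B]\<close> in \<open>\<Lambda>\<^sup>2\<^sub>7\<close> involves only the component of \<open>B\<close> in \<open>\<Lambda>\<^sup>2\<^sub>2\<^sub>1\<close>.\<close>

lemma part7_comm:
  assumes i: "i \<in> {1..7}" and B: "skew B"
  shows "part7 (comm i B) c = comm i B c - comm i (part7 B) c"
proof -
  note lB = skew_lin[OF B]
  \<comment> \<open>The Clifford relations move \<open>J i\<close> outwards past \<open>J j\<close>,
    so that summing over \<open>j\<close> leads back to \<open>fierz\<close> for \<open>B\<close>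
    itself; only \<open>j = i\<close> leaves a correction.\<close>
  have "J j (comm i B (J j c)) =
      - J i (J j (B (J j c))) + J j (B (J j (J i c)))
      + (if j = i then 2 *\<^sub>R J i (B c) - 2 *\<^sub>R B (J i c) else 0)" if j: "j \<in> {1..7}" for j
  proof -
    have 1: "J j (J i w) = - J i (J j w) + (if j = i then -2 else 0) *\<^sub>R w" for w
      using clifford[OF i j, of w] by (auto simp: algebra_simps eq_diff_eq split: if_splits)
    have "J j (comm i B (J j c)) = J j (J i (B (J j c))) - J j (B (J i (J j c)))"
      by (simp add: comm_def J_simps)
    also have "J j (J i (B (J j c))) = - J i (J j (B (J j c))) + (if j = i then -2 else 0) *\<^sub>R B (J j c)"
      by (rule 1)
    also have "J i (J j c) = - J j (J i c) + (if j = i then -2 else 0) *\<^sub>R c"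
      using clifford[OF i j, of c] by (auto simp: algebra_simps eq_diff_eq split: if_splits)
    finally show ?thesis by (simp add: lB J_simps)
  qed
  then have "(\<Sum>j=1..7. J j (comm i B (J j c))) = (\<Sum>j=1..7. - J i (J j (B (J j c))) + J j (B (J j (J i c)))
      + (if j = i then 2 *\<^sub>R J i (B c) - 2 *\<^sub>R B (J i c) else 0))"
    by (rule sum.cong[OF refl])
  also have "\<dots> = - J i (\<Sum>j=1..7. J j (B (J j c))) + (\<Sum>j=1..7. J j (B (J j (J i c))))
      + 2 *\<^sub>R comm i B c"
    using i by (simp add: sum.distrib sum_subtractf sum_negf J_sum comm_def scaleR_diff_right)
  finally have eq: "8 *\<^sub>R part7 (comm i B) c - 3 *\<^sub>R comm i B c =
      - J i (8 *\<^sub>R part7 B c - 3 *\<^sub>R B c) + (8 *\<^sub>R part7 B (J i c) - 3 *\<^sub>R B (J i c)) + 2 *\<^sub>R comm i B c"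
    unfolding fierz[OF B] fierz[OF skew_comm[OF i B]] .
  show ?thesis
  proof (rule G_eqI')
    show "G (part7 (comm i B) c) d = G (comm i B c - comm i (part7 B) c) d" for d
      using arg_cong[OF eq, of "\<lambda>x. G x d"] by (simp add: comm_def J_simps G_simps)
  qed
qed

text \<open>Invariance of the trace form: both sides are traces of products of \<open>J i\<close>,
  \<open>J j\<close> and \<open>B\<close>, compared by \<open>trace_cyclic\<close>.\<close>

lemma endo_coeff7_comm:
  assumes i: "i \<in> {1..7}" and j: "j \<in> {1..7}" and B: "skew B"
  shows "endo_coeff7 i (comm j B) = - endo_coeff7 j (comm i B)"
proof -
  have l: "linear B" using B by (simp add: skew_def)
  have lJ: "linear (\<lambda>v. J i (B v))" for i using linear_compose[OF l J_linear] by (simp add: o_def)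
  have 1: "2 * endo_coeff7 i (comm j B) = - (\<Sum>m<8. G (J i (J j (B (e m)))) (e m)) + (\<Sum>m<8. G (J i (B (J j (e m)))) (e m))"
    if "i \<in> {1..7}" for i j
    by (simp add: endo_coeff7_def comm_def J_skew[OF that] G_simps symm[of "e _"] sum_negf sum_subtractf algebra_simps)
  have 2: "(\<Sum>m<8. G (J i (B (J j (e m)))) (e m)) = (\<Sum>m<8. G (J j (J i (B (e m)))) (e m))" for i j
    using trace_cyclic[OF lJ J_linear] .
  have "2 * endo_coeff7 i (comm j B) = - (2 * endo_coeff7 j (comm i B))"
    unfolding 1[OF i] 1[OF j] 2 by simp
  then show ?thesis by simp
qed

text \<open>Since \<open>B\<close> is skew, differentiating either 2-form in a summand of
  \<open>phi_J\<close> yields a commutator, and the two metric terms are annihilated.\<close>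

lemma derivation_phi:
  assumes B: "skew B"
  shows "derivation B phi [k, x, a, b] =
    (\<Sum>j=1..7. G (comm j B k) x * G (J j a) b + G (J j k) x * G (comm j B a) b)"
proof -
  have c: "G (J j (B u)) v + G (J j u) (B v) = G (comm j B u) v" for j u v
    using skewD[OF B, of "J j u" v] by (simp add: comm_def G_simps)
  have "derivation B phi [k, x, a, b] = phi [B k, x, a, b] + phi [k, B x, a, b] + phi [k, x, B a, b] + phi [k, x, a, B b]"
    by (simp add: derivation_Cons contract_apply)
  also have "\<dots> = (\<Sum>j=1..7. (G (J j (B k)) x + G (J j k) (B x)) * G (J j a) b
      + G (J j k) x * (G (J j (B a)) b + G (J j a) (B b)))"
    unfolding phi_J by (simp add: skewD[OF B] sum.distrib algebra_simps)
  finally show ?thesis by (simp add: c)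
qed

text \<open>The first summands of \<open>derivation_phi\<close> contribute four times
  \<open>[J i, B]\<close>, the second ones, by \<open>endo_coeff7_comm\<close>, minus four times its
  projection. By \<open>part7_comm\<close> the difference is four times the commutator with
  \<open>part7 B\<close>.\<close>

lemma form_coeff7_derivation_phi:
  assumes B: "skew B" and i: "i \<in> {1..7}"
  shows "form_coeff7 i (contract x (contract k (derivation B phi))) = 4 * G (comm i (part7 B) k) x"
proof -
  have "form_coeff7 i (contract x (contract k (derivation B phi))) =
      (\<Sum>j=1..7. G (comm j B k) x * endo_coeff7 i (J j) + G (J j k) x * endo_coeff7 i (comm j B))"
    unfolding form_coeff7_def endo_coeff7_def contract_apply derivation_phi[OF B]
    by (subst sum.swap) (simp add: sum.distrib sum_distrib_left algebra_simps symm[of "J i _"])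
  also have "\<dots> = (\<Sum>j=1..7. (if j = i then 4 * G (comm i B k) x else 0) - endo_coeff7 j (comm i B) * G (J j k) x)"
    using i B by (intro sum.cong) (auto simp: endo_coeff7_J endo_coeff7_comm[of i])
  also have "\<dots> = 4 * G (comm i B k) x - (\<Sum>j=1..7. endo_coeff7 j (comm i B) * G (J j k) x)"
    using i by (simp add: sum_subtractf)
  also have "(\<Sum>j=1..7. endo_coeff7 j (comm i B) * G (J j k) x) = 4 * G (part7 (comm i B) k) x"
    by (simp add: part7_def G_sum1 G_simps sum_distrib_left)
  finally show ?thesis by (simp add: part7_comm[OF i B] G_simps)
qed

section \<open>The star of a product with \<open>phi\<close>, in degrees 1, 2 and 3\<close>

lemma hdg_wedge_phi:
  assumes "\<gamma> \<in> forms (Suc k)"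
  shows "hdg (wedge \<gamma> phi) vs = (-1) ^ k / Suc k * (\<Sum>c<8. hdg (wedge (contract (e c) \<gamma>) phi) (e c # vs))"
proof -
  \<comment> \<open>\<open>euler\<close> splits off one coframe factor, which
    \<open>hdg_wedge\<close> turns into an argument. This gives a recursion on the degree of
    \<open>\<gamma>\<close>.\<close>
  have "\<gamma> = (\<lambda>vs. (1 / Suc k) * (\<Sum>c<8. wedge (flat G (e c)) (contract (e c) \<gamma>) vs))"
    using euler[OF assms] by (auto simp: fun_eq_iff)
  then have "hdg (wedge \<gamma> phi) vs =
      hdg (wedge (\<lambda>vs. (1 / Suc k) * (\<Sum>c<8. wedge (flat G (e c)) (contract (e c) \<gamma>) vs)) phi) vs"
    by metis
  also have "\<dots> = (1 / Suc k) * (\<Sum>c<8. hdg (wedge (wedge (flat G (e c)) (contract (e c) \<gamma>)) phi) vs)"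
    by (simp only: wedge_fun_linear hdg_linear)
  also have "\<dots> = (1 / Suc k) * (\<Sum>c<8. hdg (wedge (flat G (e c)) (wedge (contract (e c) \<gamma>) phi)) vs)"
  proof -
    have "wedge (wedge (flat G (e c)) (contract (e c) \<gamma>)) phi = wedge (flat G (e c)) (wedge (contract (e c) \<gamma>) phi)" for c
      by (rule ext) (rule wedge1_assoc[OF flat_forms contract_forms[OF assms]])
    then show ?thesis by simp
  qed
  also have "\<dots> = (1 / Suc k) * (\<Sum>c<8. (-1) ^ (k + 4) * hdg (wedge (contract (e c) \<gamma>) phi) (e c # vs))"
    using hdg_wedge[OF wedge_forms[OF contract_forms[OF assms] phi_forms]] by simp
  finally show ?thesis by (simp add: sum_distrib_left power_add)
qed

lemma hdg_flat_phi: "hdg (wedge (flat G T) phi) vs = phi (T # vs)"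
  using hdg_wedge[OF phi_forms] by (simp add: hdg_phi)

lemma phi_wedge_flat: "hdg (wedge phi (flat G T)) vs = phi (T # vs)"
proof -
  have "wedge phi (flat G T) = wedge (flat G T) phi"
    using wedge_commute[OF phi_forms flat_forms] by auto
  then show ?thesis by (simp add: hdg_flat_phi)
qed

lemma hdg_wedge_phi_1:
  assumes "\<eta> \<in> forms 1"
  shows "hdg (wedge \<eta> phi) vs = (\<Sum>i<8. \<eta> [e i] * phi (e i # vs))"
proof -
  note l = forms_linear_Cons[OF phi_forms]
  show ?thesis
    by (subst forms1_expand[OF assms]) (simp add: hdg_flat_phi linear_sum[OF l] linear_scale[OF l])
qed

lemma hdg_wedge_phi_2:
  assumes "\<omega> \<in> forms 2"
  shows "hdg (wedge \<omega> phi) vs = 1/2 * (\<Sum>c<8. \<Sum>d<8. \<omega> [e c, e d] * phi (e c # e d # vs))"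
proof -
  have w: "\<omega> \<in> forms (Suc 1)" using assms by (simp add: numeral_2_eq_2)
  have "hdg (wedge \<omega> phi) vs = 1/2 * (\<Sum>c<8. - hdg (wedge (contract (e c) \<omega>) phi) (e c # vs))"
    unfolding hdg_wedge_phi[OF w] by (simp add: sum_negf)
  also have "(\<Sum>c<8. - hdg (wedge (contract (e c) \<omega>) phi) (e c # vs)) =
      (\<Sum>c<8. \<Sum>d<8. \<omega> [e c, e d] * phi (e c # e d # vs))"
  proof (intro sum.cong refl)
    fix c
    have "phi (e d # e c # vs) = - phi (e c # e d # vs)" for d by (rule form_swap[OF phi_forms])
    then show "- hdg (wedge (contract (e c) \<omega>) phi) (e c # vs) = (\<Sum>d<8. \<omega> [e c, e d] * phi (e c # e d # vs))"
      using hdg_wedge_phi_1[of "contract (e c) \<omega>" "e c # vs"] contract_forms[OF w]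
      by (simp add: contract_apply sum_negf)
  qed
  finally show ?thesis .
qed

lemma wedge_phi_2: "\<omega> \<in> forms 2 \<Longrightarrow> wedge phi \<omega> = wedge \<omega> phi"
  using wedge_commute[OF phi_forms] by auto

text \<open>By \<open>phi_J\<close>: the products of the \<open>J i\<close> give the coefficients,
  and each of the two metric terms contributes half of \<open>- \<omega>\<close>.\<close>

lemma hdg_phi_2_J:
  assumes "\<omega> \<in> forms 2"
  shows "hdg (wedge phi \<omega>) [a, b] = (\<Sum>i=1..7. form_coeff7 i \<omega> * G (J i a) b) - \<omega> [a, b]"
proof -
  have w: "\<omega> \<in> forms (Suc 1)" using assms by (simp add: numeral_2_eq_2)
  note l1 = form_expand[OF contract_forms[OF w], unfolded contract_apply]
  note l2 = form_expand[OF assms]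
  have S: "(\<Sum>c<8. \<Sum>d<8. \<omega> [e c, e d] * (G (e c) a * G (e d) b)) = \<omega> [a, b]" for a b
  proof -
    have "(\<Sum>c<8. \<Sum>d<8. \<omega> [e c, e d] * (G (e c) a * G (e d) b)) =
        (\<Sum>c<8. G a (e c) * (\<Sum>d<8. G b (e d) * \<omega> [e c, e d]))"
      by (simp add: sum_distrib_left algebra_simps symm[of "e _"])
    then show ?thesis by (simp add: l1 l2)
  qed
  have "hdg (wedge phi \<omega>) [a, b] = 1/2 * (\<Sum>c<8. \<Sum>d<8. \<omega> [e c, e d] *
     ((\<Sum>i=1..7. G (J i (e c)) (e d) * G (J i a) b) - G (e c) a * G (e d) b + G (e c) b * G (e d) a))"
    unfolding wedge_phi_2[OF assms] hdg_wedge_phi_2[OF assms] phi_J ..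
  also have "\<dots> = 1/2 * ((\<Sum>c<8. \<Sum>d<8. \<Sum>i=1..7. \<omega> [e c, e d] * (G (J i (e c)) (e d) * G (J i a) b))
      - (\<Sum>c<8. \<Sum>d<8. \<omega> [e c, e d] * (G (e c) a * G (e d) b))
      + (\<Sum>c<8. \<Sum>d<8. \<omega> [e c, e d] * (G (e c) b * G (e d) a)))"
    by (simp add: ring_distribs sum.distrib sum_subtractf sum_distrib_left)
  also have "(\<Sum>c<8. \<Sum>d<8. \<Sum>i=1..7. \<omega> [e c, e d] * (G (J i (e c)) (e d) * G (J i a) b)) =
      (\<Sum>c<8. \<Sum>i=1..7. \<Sum>d<8. \<omega> [e c, e d] * (G (J i (e c)) (e d) * G (J i a) b))"
    by (intro sum.cong refl sum.swap)
  also have "\<dots> = (\<Sum>i=1..7. \<Sum>c<8. \<Sum>d<8. \<omega> [e c, e d] * (G (J i (e c)) (e d) * G (J i a) b))"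
    by (rule sum.swap)
  also have "\<dots> = (\<Sum>i=1..7. \<Sum>c<8. \<omega> [e c, J i (e c)] * G (J i a) b)"
  proof (intro sum.cong refl)
    fix i c
    have "(\<Sum>d<8. \<omega> [e c, e d] * (G (J i (e c)) (e d) * G (J i a) b)) =
        (\<Sum>d<8. G (J i (e c)) (e d) * \<omega> [e c, e d]) * G (J i a) b"
      unfolding sum_distrib_right by (intro sum.cong refl) simp
    then show "(\<Sum>d<8. \<omega> [e c, e d] * (G (J i (e c)) (e d) * G (J i a) b)) = \<omega> [e c, J i (e c)] * G (J i a) b"
      by (simp add: l1)
  qed
  also have "\<dots> = 2 * (\<Sum>i=1..7. form_coeff7 i \<omega> * G (J i a) b)"
    by (simp add: form_coeff7_def sum_distrib_left sum_distrib_right)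
  finally show ?thesis using form_swap[OF assms, of b a "[]"] by (simp add: S)
qed

text \<open>The term \<open>- \<omega>\<close> of \<open>hdg_phi_2_J\<close> drops out because
  \<open>\<gamma>\<close> alternates, so only the coefficients of its contractions remain.\<close>

lemma hdg_wedge_phi_3:
  assumes "\<gamma> \<in> forms 3"
  shows "hdg (wedge \<gamma> phi) [v] = 1/3 * (\<Sum>c<8. \<Sum>i=1..7. form_coeff7 i (contract (e c) \<gamma>) * G (J i (e c)) v)"
proof -
  have w: "\<gamma> \<in> forms (Suc 2)" using assms by (simp add: eval_nat_numeral)
  have "hdg (wedge \<gamma> phi) [v] = 1/3 * (\<Sum>c<8. hdg (wedge (contract (e c) \<gamma>) phi) [e c, v])"
    unfolding hdg_wedge_phi[OF w] by simp
  moreover have "contract (e c) \<gamma> [e c, v] = 0" for c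
    using assms by (simp add: contract_apply forms_def)
  ultimately show ?thesis
    using hdg_phi_2_J[OF contract_forms[OF w]] wedge_phi_2[OF contract_forms[OF w]] by simp
qed

lemma proj7_J:
  assumes "\<omega> \<in> forms 2"
  shows "1/4 * (\<omega> vs + hdg (wedge phi \<omega>) vs) =
    (case vs of [a, b] \<Rightarrow> 1/4 * (\<Sum>i=1..7. form_coeff7 i \<omega> * G (J i a) b) | _ \<Rightarrow> 0)"
proof (cases "length vs = 2")
  case True
  then obtain a b where "vs = [a, b]" by (auto simp: length_Suc_conv numeral_2_eq_2)
  then show ?thesis by (simp add: hdg_phi_2_J[OF assms])
next
  case False
  have "hdg (wedge phi \<omega>) \<in> forms 2"
    using hdg_forms[OF wedge_forms[OF phi_forms assms]] by simp
  then have "hdg (wedge phi \<omega>) vs = 0" "\<omega> vs = 0" using False assms by (auto simp: forms_lengthD)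
  moreover have "(case vs of [a, b] \<Rightarrow> 1/4 * (\<Sum>i=1..7. form_coeff7 i \<omega> * G (J i a) b) | _ \<Rightarrow> 0) = 0"
    using False by (auto split: list.split)
  ultimately show ?thesis by simp
qed

section \<open>Skew endomorphisms and the Hodge star\<close>

lemma derivation_flat_forms: "linear C \<Longrightarrow> derivation C (flat G u) \<in> forms 1"
  by (rule derivation_forms1[OF flat_forms])

lemma derivation_flat: "derivation C (flat G u) [v] = G u (C v)"
  by (simp add: derivation_def)

text \<open>A derivation is determined by its values on the coframe.\<close>

lemma derivation_expand:
  assumes "\<omega> \<in> forms k" "linear C"
  shows "derivation C \<omega> vs = (\<Sum>m<8. wedge (derivation C (flat G (e m))) (contract (e m) \<omega>) vs)"
  using assms(1)
proof (induction vs arbitrary: \<omega> k)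
  case Nil
  then show ?case using forms_lengthD[OF derivation_flat_forms[OF assms(2)], of "[]"] by simp
next
  case (Cons v vs)
  have sw: "contract v (contract (e c) \<omega>) = (\<lambda>vs. - contract (e c) (contract v \<omega>) vs)" for c
    using form_swap[OF Cons.prems, of v "e c"] by (simp add: contract_apply fun_eq_iff)
  have "\<omega> (C v # vs) = (\<Sum>m<8. G (e m) (C v) * \<omega> (e m # vs))"
    using form_expand[OF Cons.prems, of "C v"] by (simp add: symm)
  moreover have "derivation C (contract v \<omega>) vs =
      (\<Sum>m<8. wedge (derivation C (flat G (e m))) (contract (e m) (contract v \<omega>)) vs)"
    by (rule Cons.IH[OF contract_forms'[OF Cons.prems]])
  ultimately show ?case
    unfolding derivation_Cons wedge1_Cons[OF derivation_flat_forms[OF assms(2)]] sw derivation_flat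
    by (simp add: wedge_linear sum.distrib contract_apply[of _ \<omega> vs])
qed

lemma derivation_forms:
  assumes "\<omega> \<in> forms k" "linear C"
  shows "derivation C \<omega> \<in> forms k"
proof (cases k)
  case 0
  then have "derivation C \<omega> = (\<lambda>_. 0)"
    using derivation_expand[OF assms] assms(1) by (auto simp: contract_forms_0 wedge_fun_linear)
  then show ?thesis by simp
next
  case (Suc k')
  have "derivation C \<omega> = (\<lambda>vs. \<Sum>m<8. wedge (derivation C (flat G (e m))) (contract (e m) \<omega>) vs)"
    using derivation_expand[OF assms] by auto
  also have "\<dots> \<in> forms k"
    unfolding Suc using assms Suc
    by (intro forms_sum wedge1_forms derivation_flat_forms contract_forms) auto
  finally show ?thesis .
qed

lemma derivation_flat_skew:
  assumes "skew B"
  shows "derivation B (flat G u) = (\<lambda>vs. - flat G (B u) vs)"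
proof
  fix vs
  have "G u (B v) = - G (B u) v" for v using skewD[OF assms, of u v] by simp
  then show "derivation B (flat G u) vs = - flat G (B u) vs"
    unfolding derivation_forms1_apply[OF flat_forms]
    by (cases vs rule: remdups_adj.cases) (simp_all add: flat_def)
qed

text \<open>The star exchanges wedge products and contractions in \<open>derivation_expand\<close>,
  and skewness of \<open>B\<close> exchanges them back; self-duality of \<open>phi\<close> does the
  rest.\<close>

lemma hdg_derivation_phi:
  assumes B: "skew B"
  shows "hdg (derivation B phi) vs = derivation B phi vs"
proof -
  have l: "linear B" using B by (simp add: skew_def)
  have d: "derivation B phi = (\<lambda>vs. \<Sum>m<8. - wedge (flat G (B (e m))) (contract (e m) phi) vs)"
    using derivation_expand[OF phi_forms l] by (simp add: fun_eq_iff derivation_flat_skew[OF B] wedge_linear)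
  have hc: "hdg (contract v phi) = (\<lambda>vs. - wedge (flat G v) phi vs)" for v
  proof -
    have "hdg phi = phi" by (rule ext) (rule hdg_phi)
    then show ?thesis using hdg_contract[OF phi_forms] by auto
  qed
  have phi3: "contract v phi \<in> forms 3" for v using contract_forms'[OF phi_forms, of v] by simp
  have "hdg (derivation B phi) vs = (\<Sum>m<8. hdg (contract (e m) phi) (B (e m) # vs))"
    unfolding d by (simp add: hdg_linear hdg_wedge[OF phi3])
  also have "\<dots> = (\<Sum>m<8. wedge (flat G (e m)) (contract (B (e m)) phi) vs)"
    unfolding hc wedge_flat_Cons using skew_diag[OF B] by (simp add: symm[of "e _"])
  \<comment> \<open>\<open>B\<close> has to move from the contraction back to the coframe factor:
    expand \<open>B (e m)\<close>, exchange the sums and use skewness.\<close>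
  also have "\<dots> = (\<Sum>m<8. \<Sum>l<8. G (B (e m)) (e l) * wedge (flat G (e m)) (contract (e l) phi) vs)"
  proof (intro sum.cong refl)
    fix m
    have "contract (B (e m)) phi = (\<lambda>vs. \<Sum>l<8. G (B (e m)) (e l) * contract (e l) phi vs)"
      using form_expand[OF phi_forms] by (simp add: fun_eq_iff contract_apply)
    then show "wedge (flat G (e m)) (contract (B (e m)) phi) vs =
      (\<Sum>l<8. G (B (e m)) (e l) * wedge (flat G (e m)) (contract (e l) phi) vs)"
      by (simp add: wedge_linear)
  qed
  also have "\<dots> = (\<Sum>l<8. \<Sum>m<8. G (B (e m)) (e l) * wedge (flat G (e m)) (contract (e l) phi) vs)"
    by (rule sum.swap)
  also have "\<dots> = (\<Sum>l<8. - wedge (flat G (B (e l))) (contract (e l) phi) vs)"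
  proof (intro sum.cong refl)
    fix l
    have "wedge (flat G (B (e l))) (contract (e l) phi) vs =
        (\<Sum>m<8. G (B (e l)) (e m) * wedge (flat G (e m)) (contract (e l) phi) vs)"
      by (subst flat_expand) (simp add: wedge_linear)
    then show "(\<Sum>m<8. G (B (e m)) (e l) * wedge (flat G (e m)) (contract (e l) phi) vs) =
        - wedge (flat G (B (e l))) (contract (e l) phi) vs"
      by (simp add: skewD[OF B, of "e _" "e l"] symm[of "e _"] sum_negf)
  qed
  finally show ?thesis by (simp add: d)
qed

end

lemma endo_form_apply [simp]: "endo_form G A [a, b] = G (A a) b"
  by (simp add: endo_form_def)

lemma derivation_sub_endo:
  assumes "\<omega> \<in> forms k"
  shows "derivation (\<lambda>v. A v - B v) \<omega> vs = derivation A \<omega> vs - derivation B \<omega> vs"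
proof -
  have "\<omega> (vs[k := A (vs ! k) - B (vs ! k)]) = \<omega> (vs[k := A (vs ! k)]) - \<omega> (vs[k := B (vs ! k)])"
    if "k < length vs" for k
    using linear_diff[OF forms_linear[OF assms, of "take k vs" "drop (Suc k) vs"]] that
    by (simp add: upd_conv_take_nth_drop)
  then show ?thesis by (simp add: derivation_def sum_subtractf)
qed

context frame8
begin

lemma forms1_expand':
  assumes "\<eta> \<in> forms 1"
  shows "\<eta> = (\<lambda>vs. \<Sum>l<8. \<eta> [e l] * flat G (e l) vs)"
proof
  fix vs
  show "\<eta> vs = (\<Sum>l<8. \<eta> [e l] * flat G (e l) vs)"
  proof (cases "length vs = 1")
    case True
    then obtain v where "vs = [v]" by (auto simp: length_Suc_conv)
    then show ?thesis
      using form_expand[OF assms, of v "[]"] by (simp add: symm[of "e _"] mult.commute)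
  qed (simp add: forms_lengthD[OF assms] forms_lengthD[OF flat_forms])
qed

text \<open>This is why the Christoffel symbols drop out of the exterior derivative.\<close>

lemma wedge_derivation_symmetric:
  assumes sym: "\<And>u v. S u v = S v u" and lin: "\<And>u. linear (S u)" and \<omega>: "\<omega> \<in> forms k"
  shows "(\<Sum>k<8. wedge (flat G (e k)) (derivation (S (e k)) \<omega>) vs) = 0"
proof -
  have d: "derivation (S u) (flat G w) = (\<lambda>vs. \<Sum>l<8. G w (S u (e l)) * flat G (e l) vs)" for u w
    using forms1_expand'[OF derivation_flat_forms[OF lin, of u w]] by (simp add: derivation_flat)
  have d\<omega>: "derivation (S u) \<omega> = (\<lambda>vs. \<Sum>m<8. \<Sum>l<8. G (e m) (S u (e l)) * wedge (flat G (e l)) (contract (e m) \<omega>) vs)" for u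
    using derivation_expand[OF \<omega> lin, of u] by (simp add: fun_eq_iff d wedge_linear)
  define T where "T m k l = G (e m) (S (e k) (e l)) * wedge (flat G (e k)) (wedge (flat G (e l)) (contract (e m) \<omega>)) vs" for m k l
  \<comment> \<open>Exchanging \<open>k\<close> and \<open>l\<close> leaves the symmetric
    coefficient unchanged and reverses the sign of the wedge product.\<close>
  have T: "T m k l = - T m l k" for m k l
    using wedge1_anticommute[OF flat_forms flat_forms] sym[of "e k" "e l"] unfolding T_def
    by (metis mult_minus_right)
  have "(\<Sum>k<8. wedge (flat G (e k)) (derivation (S (e k)) \<omega>) vs) = (\<Sum>k<8. \<Sum>m<8. \<Sum>l<8. T m k l)"
    unfolding d\<omega> T_def by (simp add: wedge_linear)
  also have "\<dots> = (\<Sum>m<8. \<Sum>k<8. \<Sum>l<8. T m k l)" by (rule sum.swap)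
  also have "\<dots> = (\<Sum>m<(8::nat). 0)"
  proof (rule sum.cong[OF refl])
    fix m
    have "(\<Sum>k<8. \<Sum>l<8. T m k l) = (\<Sum>k<8. \<Sum>l<8. - T m l k)"
      by (intro sum.cong refl T)
    also have "\<dots> = - (\<Sum>k<8. \<Sum>l<8. T m k l)"
      by (subst sum.swap) (simp add: sum_negf)
    finally show "(\<Sum>k<8. \<Sum>l<8. T m k l) = 0" by simp
  qed
  finally show ?thesis by simp
qed

section \<open>Contractions of \<open>phi\<close> and the splitting of 3-forms\<close>

lemma form_coeff7_contract_phi:
  assumes i: "i \<in> {1..7}"
  shows "form_coeff7 i (contract x (contract T phi)) = 3 * G (J i T) x"
proof -
  \<comment> \<open>The factor 3 arises as 4 from the products of the \<open>J j\<close> minus 1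
    from the metric terms.\<close>
  have "2 * form_coeff7 i (contract x (contract T phi)) =
      (\<Sum>c<8. (\<Sum>j=1..7. G (J j T) x * G (J j (e c)) (J i (e c))) - G T (e c) * G x (J i (e c)) + G T (J i (e c)) * G x (e c))"
    by (simp add: form_coeff7_def contract_apply phi_J)
  also have "\<dots> = (\<Sum>j=1..7. G (J j T) x * (2 * endo_coeff7 i (J j)))
      - (\<Sum>c<8. G T (e c) * G x (J i (e c))) + (\<Sum>c<8. G x (e c) * G T (J i (e c)))"
    unfolding sum.distrib sum_subtractf
    by (subst sum.swap) (simp add: endo_coeff7_def sum_distrib_left symm[of "J i _"] mult.commute)
  also have "(\<Sum>c<8. G T (e c) * G x (J i (e c))) = G x (J i T)"
    by (rule linear_expand_real) (auto intro!: linearI simp: J_simps G_simps)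
  also have "(\<Sum>c<8. G x (e c) * G T (J i (e c))) = G T (J i x)"
    by (rule linear_expand_real) (auto intro!: linearI simp: J_simps G_simps)
  also have "(\<Sum>j=1..7. G (J j T) x * (2 * endo_coeff7 i (J j))) = (\<Sum>j=1..7. if j = i then 8 * G (J i T) x else 0)"
    using i by (intro sum.cong) (auto simp: endo_coeff7_J)
  finally show ?thesis
    using i J_skew[OF i, of T x] symm[of x "J i T"] by simp
qed

lemma sum_G_J: "(\<Sum>c<8. G w (e c) * G (J i (e c)) v) = G (J i w) v"
  by (rule linear_expand_real) (auto intro!: linearI simp: J_simps G_simps)

lemma hdg_wedge_forms3:
  assumes "\<gamma> \<in> forms 3"
  shows "hdg (wedge \<gamma> phi) \<in> forms 1"
  using hdg_forms[OF wedge_forms[OF assms phi_forms]] by simp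

lemma forms1_eqI:
  assumes "\<alpha> \<in> forms 1" "\<And>v. \<alpha> [v] = G T v"
  shows "\<alpha> = flat G T"
proof
  fix vs show "\<alpha> vs = flat G T vs"
  proof (cases "length vs = 1")
    case True
    then obtain v where "vs = [v]" by (auto simp: length_Suc_conv)
    then show ?thesis using assms by simp
  qed (simp add: forms_lengthD[OF assms(1)] forms_lengthD[OF flat_forms])
qed

lemma contract_phi_forms: "contract T phi \<in> forms 3"
  using contract_forms'[OF phi_forms, of T] by simp

text \<open>The seven squares \<open>J i (J i T) = - T\<close> add up. Thus the product with
  \<open>phi\<close> detects \<open>T\<close>, and with it the component of a 3-form in
  \<open>Lambda3_8\<close>.\<close>

lemma hdg_wedge_contract_phi: "hdg (wedge (contract T phi) phi) = flat G (- 7 *\<^sub>R T)"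
proof (rule forms1_eqI[OF hdg_wedge_forms3[OF contract_phi_forms]])
  fix v
  have "hdg (wedge (contract T phi) phi) [v] = (\<Sum>c<8. \<Sum>i=1..7. G (J i T) (e c) * G (J i (e c)) v)"
    by (simp add: hdg_wedge_phi_3[OF contract_phi_forms] form_coeff7_contract_phi sum_distrib_left)
  also have "\<dots> = (\<Sum>i=1..7. G (J i (J i T)) v)"
    by (subst sum.swap) (simp only: sum_G_J)
  also have "\<dots> = (\<Sum>i=1..(7::nat). - G T v)"
    by (intro sum.cong refl) (simp add: J_sq G_simps)
  finally show "hdg (wedge (contract T phi) phi) [v] = G (- 7 *\<^sub>R T) v"
    by (simp add: G_simps)
qed

text \<open>By \<open>hdg_wedge_contract_phi\<close>, adding \<open>contract T phi\<close> cancels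
  the product of \<open>\<gamma>\<close> with \<open>phi\<close>, so the sum lies in
  \<open>Lambda3_48\<close>.\<close>

lemma proj48_eq:
  assumes h: "hodge G phi = hdg" and \<gamma>: "\<gamma> \<in> forms 3" and T: "hdg (wedge \<gamma> phi) = flat G (7 *\<^sub>R T)"
  shows "proj48 G phi \<gamma> = (\<lambda>vs. \<gamma> vs + contract T phi vs)"
  unfolding proj48_def
proof (rule the_equality)
  let ?\<gamma>' = "\<lambda>vs. \<gamma> vs + contract T phi vs"
  have comm: "wedge phi \<beta> = wedge \<beta> phi" if "\<beta> \<in> forms 3" for \<beta>
    using wedge_commute[OF phi_forms that] by auto
  have f: "?\<gamma>' \<in> forms 3" using \<gamma> contract_phi_forms by (rule forms_add)
  have "hdg (wedge ?\<gamma>' phi) vs = 0" for vs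
    unfolding wedge_fun_linear hdg_linear T hdg_wedge_contract_phi
    by (simp add: flat_def G_simps split: list.split)
  then have "wedge ?\<gamma>' phi = (\<lambda>_. 0)"
    using hdg_eq_0[OF wedge_forms[OF f phi_forms]] by auto
  moreover have "(\<lambda>vs. \<gamma> vs - ?\<gamma>' vs) = hdg (wedge phi (flat G (- T)))"
  proof
    fix vs
    show "\<gamma> vs - ?\<gamma>' vs = hdg (wedge phi (flat G (- T))) vs"
      using linear_neg[OF forms_linear_Cons[OF phi_forms], of T vs]
      by (simp add: phi_wedge_flat contract_apply)
  qed
  ultimately show "?\<gamma>' \<in> Lambda3_48 phi \<and> (\<lambda>vs. \<gamma> vs - ?\<gamma>' vs) \<in> Lambda3_8 G phi"
    using f flat_forms unfolding Lambda3_48_def Lambda3_8_def h by (auto simp: comm[OF f])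
next
  fix \<gamma>'' assume *: "\<gamma>'' \<in> Lambda3_48 phi \<and> (\<lambda>vs. \<gamma> vs - \<gamma>'' vs) \<in> Lambda3_8 G phi"
  then have f: "\<gamma>'' \<in> forms 3" and w: "wedge phi \<gamma>'' = (\<lambda>_. 0)" by (auto simp: Lambda3_48_def)
  from * obtain \<eta> where \<eta>: "\<eta> \<in> forms 1" and d: "(\<lambda>vs. \<gamma> vs - \<gamma>'' vs) = hdg (wedge phi \<eta>)"
    unfolding Lambda3_8_def h by auto
  \<comment> \<open>The vector dual to \<open>\<eta>\<close>. The difference is
    \<open>contract U phi\<close>, and comparing products with \<open>phi\<close> forces
    \<open>U = - T\<close>, hence uniqueness.\<close>
  define U where "U = (\<Sum>i<8. \<eta> [e i] *\<^sub>R e i)"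
  have dU: "(\<lambda>vs. \<gamma> vs - \<gamma>'' vs) = contract U phi"
    unfolding d by (subst forms1_expand[OF \<eta>]) (simp add: fun_eq_iff phi_wedge_flat contract_apply U_def)
  have "wedge \<gamma>'' phi = (\<lambda>_. 0)" using w wedge_commute[OF phi_forms f] by auto
  then have "hdg (wedge (\<lambda>vs. \<gamma> vs - \<gamma>'' vs) phi) = hdg (wedge \<gamma> phi)"
    by (simp add: wedge_fun_linear)
  then have "flat G (- 7 *\<^sub>R U) = flat G (7 *\<^sub>R T)"
    unfolding dU hdg_wedge_contract_phi T .
  then have "G (- 7 *\<^sub>R U) v = G (7 *\<^sub>R T) v" for v by (metis flat_apply)
  then have "G (- U) v = G T v" for v by (simp add: G_simps)
  then have "- U = T" by (rule G_eqI')
  then have "U = - T" by auto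
  then have "\<gamma> vs - \<gamma>'' vs = - contract T phi vs" for vs
    using fun_cong[OF dU, of vs] linear_neg[OF forms_linear_Cons[OF phi_forms], of T vs]
    by (simp add: contract_apply)
  then show "\<gamma>'' = (\<lambda>vs. \<gamma> vs + contract T phi vs)"
    by (simp add: fun_eq_iff algebra_simps)
qed

lemma form_coeff7_linear:
  "form_coeff7 i (\<lambda>vs. \<alpha> vs + \<beta> vs) = form_coeff7 i \<alpha> + form_coeff7 i \<beta>"
  "form_coeff7 i (\<lambda>vs. \<Sum>k\<in>I. \<gamma> k vs) = (\<Sum>k\<in>I. form_coeff7 i (\<gamma> k))"
proof -
  show "form_coeff7 i (\<lambda>vs. \<alpha> vs + \<beta> vs) = form_coeff7 i \<alpha> + form_coeff7 i \<beta>"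
    by (simp add: form_coeff7_def sum.distrib distrib_left)
  show "form_coeff7 i (\<lambda>vs. \<Sum>k\<in>I. \<gamma> k vs) = (\<Sum>k\<in>I. form_coeff7 i (\<gamma> k))"
    unfolding form_coeff7_def by (subst sum.swap) (simp add: sum_distrib_left)
qed

lemma form_coeff7_wedge_flat:
  assumes i: "i \<in> {1..7}"
  shows "form_coeff7 i (wedge (flat G x) (flat G T)) = G T (J i x)"
proof -
  have n: "flat G x [] = 0" by (simp add: flat_def)
  have "2 * form_coeff7 i (wedge (flat G x) (flat G T)) =
      (\<Sum>c<8. G x (e c) * G T (J i (e c))) - (\<Sum>c<8. G T (e c) * G x (J i (e c)))"
    by (simp add: form_coeff7_def wedge_flat_Cons contract_apply sum_subtractf mult.commute n)
  also have "(\<Sum>c<8. G T (e c) * G x (J i (e c))) = G x (J i T)"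
    by (rule linear_expand_real) (auto intro!: linearI simp: J_simps G_simps)
  also have "(\<Sum>c<8. G x (e c) * G T (J i (e c))) = G T (J i x)"
    by (rule linear_expand_real) (auto intro!: linearI simp: J_simps G_simps)
  finally show ?thesis using J_skew[OF i, of T x] symm[of x "J i T"] by simp
qed

lemma form_coeff7_endo_form: "form_coeff7 i (endo_form G B) = endo_coeff7 i B"
  by (simp add: form_coeff7_def endo_coeff7_def symm[of "B _"])

abbreviation frame_proj7 :: "form \<Rightarrow> form" where
  "frame_proj7 \<omega> \<equiv> \<lambda>vs. 1/4 * (\<omega> vs + hdg (wedge phi \<omega>) vs)"

lemma endo_form_forms:
  assumes "skew B"
  shows "endo_form G B \<in> forms 2"
proof -
  have "endo_form G B \<in> forms (Suc (Suc 0))"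
  proof (rule forms_SucI)
    fix v
    have "contract v (endo_form G B) = flat G (B v)"
      by (auto simp: contract_apply endo_form_def flat_def split: list.split)
    then show "contract v (endo_form G B) \<in> forms (Suc 0)" using flat_forms by simp
  next
    fix vs
    show "linear (\<lambda>v. endo_form G B (v # vs))"
      by (cases vs rule: remdups_adj.cases)
        (auto intro!: linearI simp: endo_form_def skew_lin[OF assms] G_simps)
  next
    show "endo_form G B (v # v # vs) = 0" for v vs
      using skew_diag[OF assms] by (simp add: endo_form_def split: list.split)
  qed (simp add: endo_form_def)
  then show ?thesis by (simp add: numeral_2_eq_2)
qed

lemma frame_proj7_endo_form:
  assumes "skew B"
  shows "frame_proj7 (endo_form G B) = endo_form G (part7 B)"
  unfolding proj7_J[OF endo_form_forms[OF assms]] form_coeff7_endo_form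
  by (auto simp: fun_eq_iff endo_form_def part7_def G_sum1 G_simps sum_distrib_left split: list.split)

text \<open>The family \<open>B\<close> plays the role of the connection form at a point, evaluated on the frame.\<close>

context
  fixes B :: "nat \<Rightarrow> real^8 \<Rightarrow> real^8" and \<delta> :: form and X :: "real^8"
  assumes skewB: "\<And>k. skew (B k)"
  defines "\<delta> \<equiv> \<lambda>vs. \<Sum>k<8. contract (e k) (derivation (B k) phi) vs"
begin

lemma linB: "linear (B k)"
  using skewB by (simp add: skew_def)

lemma \<delta>_forms: "\<delta> \<in> forms 3"
  unfolding \<delta>_def
  using contract_forms'[OF derivation_forms[OF phi_forms linB]] by (auto intro!: forms_sum)

lemma form_coeff7_contract_\<delta>:
  assumes "i \<in> {1..7}"
  shows "form_coeff7 i (contract x \<delta>) = 4 * (\<Sum>k<8. G (comm i (part7 (B k)) (e k)) x)"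
proof -
  have "contract x \<delta> = (\<lambda>vs. \<Sum>k<8. contract x (contract (e k) (derivation (B k) phi)) vs)"
    by (auto simp: \<delta>_def contract_apply)
  then show ?thesis
    using form_coeff7_derivation_phi[OF skewB assms] by (simp add: form_coeff7_linear sum_distrib_left)
qed

text \<open>The vector dual to the Lee form; the constant is \<open>4/3 * (-12) / 7\<close>, as
  computed in \<open>hdg_wedge_\<delta>\<close>.\<close>

definition lee_vec :: "real^8" where
  "lee_vec = - (16/7) *\<^sub>R (\<Sum>k<8. part7 (B k) (e k))"

lemma hdg_wedge_\<delta>: "hdg (wedge \<delta> phi) = flat G (7 *\<^sub>R lee_vec)"
proof (rule forms1_eqI[OF hdg_wedge_forms3[OF \<delta>_forms]])
  fix v
  \<comment> \<open>With \<open>A = part7 B\<close>, each \<open>J i [J i, A]\<close> is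
    \<open>- A - J i A J i\<close>; these add up to \<open>- 7 A\<close> and, by
    \<open>sum_J_part7_J\<close>, \<open>- 5 A\<close>.\<close>
  have s: "(\<Sum>i=1..7. J i (comm i (part7 B) w)) = - 12 *\<^sub>R part7 B w" for B w
  proof -
    have "(\<Sum>i=1..7. J i (comm i (part7 B) w)) = (\<Sum>i=1..7. - part7 B w - J i (part7 B (J i w)))"
      by (intro sum.cong refl) (simp add: comm_def J_simps J_sq)
    also have "\<dots> = - 7 *\<^sub>R part7 B w - 5 *\<^sub>R part7 B w"
      unfolding sum_subtractf sum_J_part7_J by (simp add: sum_constant_scaleR del: sum_constant)
    finally show ?thesis by (simp only: flip: scaleR_diff_left) simp
  qed
  have "hdg (wedge \<delta> phi) [v] =
      4/3 * (\<Sum>c<8. \<Sum>i=1..7. \<Sum>k<8. G (comm i (part7 (B k)) (e k)) (e c) * G (J i (e c)) v)"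
    by (simp add: hdg_wedge_phi_3[OF \<delta>_forms] form_coeff7_contract_\<delta> sum_distrib_left sum_distrib_right mult.assoc)
  also have "(\<Sum>c<8. \<Sum>i=1..7. \<Sum>k<8. G (comm i (part7 (B k)) (e k)) (e c) * G (J i (e c)) v) =
      (\<Sum>i=1..7. \<Sum>c<8. \<Sum>k<8. G (comm i (part7 (B k)) (e k)) (e c) * G (J i (e c)) v)"
    by (rule sum.swap)
  also have "\<dots> = (\<Sum>i=1..7. \<Sum>k<8. G (J i (comm i (part7 (B k)) (e k))) v)"
  proof (rule sum.cong[OF refl])
    fix i :: nat
    show "(\<Sum>c<8. \<Sum>k<8. G (comm i (part7 (B k)) (e k)) (e c) * G (J i (e c)) v) =
        (\<Sum>k<8. G (J i (comm i (part7 (B k)) (e k))) v)"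
      by (subst sum.swap) (simp only: sum_G_J)
  qed
  also have "\<dots> = (\<Sum>k<8. G (\<Sum>i=1..7. J i (comm i (part7 (B k)) (e k))) v)"
    unfolding G_sum1 by (rule sum.swap)
  also have "\<dots> = - 12 * G (\<Sum>k<8. part7 (B k) (e k)) v"
    unfolding s by (simp add: G_sum1 G_simps sum_distrib_left sum_negf)
  finally show "hdg (wedge \<delta> phi) [v] = G (7 *\<^sub>R lee_vec) v"
    by (simp add: lee_vec_def G_simps)
qed

abbreviation "BX \<equiv> \<lambda>v. \<Sum>k<8. G X (e k) *\<^sub>R B k v"

lemma endo_coeff7_BX:
  assumes i: "i \<in> {1..7}"
  shows "- endo_coeff7 i BX = - (1/2) * form_coeff7 i (contract X \<delta>) + 7/4 * form_coeff7 i (wedge (flat G X) (flat G lee_vec))"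
proof -
  let ?t = "\<Sum>k<8. part7 (B k) (e k)"
  have "endo_coeff7 i BX = (\<Sum>k<8. G X (e k) * endo_coeff7 i (B k))"
    unfolding endo_coeff7_def G_sum2 G_simps
    by (subst sum.swap) (simp add: sum_distrib_left mult.left_commute)
  \<comment> \<open>\<open>J_part7\<close> read backwards: the coefficient times \<open>e k\<close>
    is -2 times the anticommutator at \<open>e k\<close>.\<close>
  also have "\<dots> = (\<Sum>k<8. - 2 * G (J i (part7 (B k) (e k)) + part7 (B k) (J i (e k))) X)"
    by (simp add: J_part7[OF i] G_simps symm[of X] mult.commute)
  \<comment> \<open>An anticommutator is twice the product minus the commutator: the commutators
    make up \<open>\<delta>\<close>, the products the Lee vector.\<close>
  also have "\<dots> = (\<Sum>k<8. 2 * G (comm i (part7 (B k)) (e k)) X) - 4 * (\<Sum>k<8. G (J i (part7 (B k) (e k))) X)"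
    by (simp add: comm_def G_simps sum_subtractf[symmetric] sum_distrib_left algebra_simps)
  also have "(\<Sum>k<8. 2 * G (comm i (part7 (B k)) (e k)) X) = 1/2 * form_coeff7 i (contract X \<delta>)"
    by (simp add: form_coeff7_contract_\<delta>[OF i] sum_distrib_left)
  also have "(\<Sum>k<8. G (J i (part7 (B k) (e k))) X) = 7/16 * form_coeff7 i (wedge (flat G X) (flat G lee_vec))"
    by (simp add: form_coeff7_wedge_flat[OF i] lee_vec_def G_simps J_skew[OF i] G_sum1 sum_negf)
  finally show ?thesis by simp
qed

text \<open>Both sides lie in the span of the \<open>J i\<close>, so it suffices to compare
  coefficients.\<close>

lemma frame_proj7_combination:
  assumes "\<alpha> \<in> forms 2" "\<beta> \<in> forms 2"
    and "\<And>i. i \<in> {1..7} \<Longrightarrow> - endo_coeff7 i BX = a * form_coeff7 i \<alpha> + b * form_coeff7 i \<beta>"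
  shows "endo_form G (\<lambda>v. - part7 BX v) = (\<lambda>vs. a * frame_proj7 \<alpha> vs + b * frame_proj7 \<beta> vs)"
proof -
  have "- G (part7 BX u) v = a * (1/4 * (\<Sum>i=1..7. form_coeff7 i \<alpha> * G (J i u) v)) + b * (1/4 * (\<Sum>i=1..7. form_coeff7 i \<beta> * G (J i u) v))" for u v
  proof -
    have "- G (part7 BX u) v = (\<Sum>i=1..7. (- endo_coeff7 i BX) * (1/4 * G (J i u) v))"
      by (simp add: part7_def G_sum1 G_simps sum_negf)
    also have "\<dots> = (\<Sum>i=1..7. (a * form_coeff7 i \<alpha> + b * form_coeff7 i \<beta>) * (1/4 * G (J i u) v))"
      by (intro sum.cong refl) (simp only: assms(3))
    finally show ?thesis by (simp add: sum.distrib sum_distrib_left algebra_simps)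
  qed
  then show ?thesis
    unfolding proj7_J[OF assms(1)] proj7_J[OF assms(2)]
    by (auto simp: fun_eq_iff endo_form_def G_simps split: list.split)
qed

lemma wedge_flat_flat_forms: "wedge (flat G u) (flat G v) \<in> forms 2"
  using wedge_forms[OF flat_forms flat_forms] by (simp add: numeral_2_eq_2)

lemma contract_forms_3: "\<gamma> \<in> forms 3 \<Longrightarrow> contract v \<gamma> \<in> forms 2"
  using contract_forms'[of \<gamma> 3] by simp

lemma torsion_formula_1:
  "endo_form G (\<lambda>v. - part7 BX v) =
    (\<lambda>vs. - (1/2) * frame_proj7 (contract X \<delta>) vs + 7/4 * frame_proj7 (wedge (flat G X) (flat G lee_vec)) vs)"
  by (rule frame_proj7_combination[OF contract_forms_3[OF \<delta>_forms] wedge_flat_flat_forms endo_coeff7_BX])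

text \<open>Passing to the component in \<open>Lambda3_48\<close> adds
  \<open>contract lee_vec phi\<close>, whose contraction with \<open>X\<close> has -3 times the
  coefficients of the wedge product of \<open>X\<close> and \<open>lee_vec\<close>. This accounts
  for \<open>7/4 - 3/2 = 1/4\<close>.\<close>

lemma torsion_formula_2:
  "endo_form G (\<lambda>v. - part7 BX v) =
    (\<lambda>vs. - (1/2) * frame_proj7 (contract X (\<lambda>vs. \<delta> vs + contract lee_vec phi vs)) vs
      + 1/4 * frame_proj7 (wedge (flat G X) (flat G lee_vec)) vs)"
proof (rule frame_proj7_combination[OF contract_forms_3 wedge_flat_flat_forms])
  show "(\<lambda>vs. \<delta> vs + contract lee_vec phi vs) \<in> forms 3"
    using \<delta>_forms contract_phi_forms by (rule forms_add)
  fix i :: nat assume i: "i \<in> {1..7}"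
  have c: "contract X (\<lambda>vs. \<delta> vs + contract lee_vec phi vs) = (\<lambda>vs. contract X \<delta> vs + contract X (contract lee_vec phi) vs)"
    by (auto simp: contract_apply)
  show "- endo_coeff7 i BX = - (1/2) * form_coeff7 i (contract X (\<lambda>vs. \<delta> vs + contract lee_vec phi vs))
      + 1/4 * form_coeff7 i (wedge (flat G X) (flat G lee_vec))"
    unfolding endo_coeff7_BX[OF i] c form_coeff7_linear form_coeff7_contract_phi[OF i] form_coeff7_wedge_flat[OF i]
    by (simp add: J_skew[OF i] algebra_simps)
qed

end

end


section \<open>The Levi-Civita connection in a chart\<close>

lemma smooth_on_differentiable:
  assumes "smooth_on S f" "x \<in> S"
  shows "f differentiable (at x)"
proof -
  have "Ck_on 1 S f" using assms by (simp add: smooth_on_def)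
  with assms(2) show ?thesis by simp
qed

lemma has_derivative_wedge:
  assumes "\<And>vs. ((\<lambda>y. \<alpha> y vs) has_derivative (\<lambda>u. \<alpha>' u vs)) (at x)"
    and "\<And>vs. ((\<lambda>y. \<beta> y vs) has_derivative (\<lambda>u. \<beta>' u vs)) (at x)"
  shows "((\<lambda>y. wedge (\<alpha> y) (\<beta> y) vs) has_derivative
    (\<lambda>u. wedge (\<alpha>' u) (\<beta> x) vs + wedge (\<alpha> x) (\<beta>' u) vs)) (at x)"
  unfolding wedge_def sum.distrib[symmetric]
  by (rule has_derivative_sum) (auto intro!: derivative_eq_intros assms simp: algebra_simps)

lemma eq_sum_Basis: "linear f \<Longrightarrow> f v = (\<Sum>b\<in>Basis. (v \<bullet> b) *\<^sub>R f b)"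
  by (metis (no_types, lifting) euclidean_representation linear_scale linear_sum sum.cong)

text \<open>The situation around one point \<open>x\<close> of a chart. The adapted frame
  \<open>f\<close> lives on a neighbourhood because it is differentiated; in the application it is
  the frame chosen by \<open>minimal_connection\<close>.\<close>

locale spin7_chart =
  fixes g :: "real^8 \<Rightarrow> scalar_product" and \<phi> :: "real^8 \<Rightarrow> form"
    and N :: "(real^8) set" and x :: "real^8" and f :: "real^8 \<Rightarrow> nat \<Rightarrow> real^8"
  assumes N: "open N" "x \<in> N"
    and g_bilinear: "\<And>y. y \<in> N \<Longrightarrow> bilinear (g y)"
    and g_sym: "\<And>y u v. y \<in> N \<Longrightarrow> g y u v = g y v u"
    and g_diff: "\<And>u v. (\<lambda>y. g y u v) differentiable (at x)"
    and f_diff: "\<And>i. i < 8 \<Longrightarrow> (\<lambda>y. f y i) differentiable (at x)"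
    and f_frame: "\<And>y. y \<in> N \<Longrightarrow> spin7_frame (g y) (\<phi> y) (f y)"
begin

definition dg :: "real^8 \<Rightarrow> real^8 \<Rightarrow> real^8 \<Rightarrow> real" where
  "dg u v w = frechet_derivative (\<lambda>y. g y v w) (at x) u"

lemma has_derivative_g: "((\<lambda>y. g y v w) has_derivative (\<lambda>u. dg u v w)) (at x)"
  unfolding dg_def using g_diff[of v w] by (simp add: frechet_derivative_works)

lemma g_lin:
  assumes "y \<in> N"
  shows "linear (g y v)" "linear (\<lambda>u. g y u v)"
  using g_bilinear[OF assms] by (auto simp: bilinear_def)

text \<open>Lets pointwise identities on \<open>N\<close> be differentiated at
  \<open>x\<close>.\<close>

lemma derivative_unique_N:
  assumes "(F has_derivative F') (at x)" "(H has_derivative H') (at x)" "\<And>y. y \<in> N \<Longrightarrow> F y = H y"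
  shows "F' u = H' u"
proof -
  have "(H has_derivative F') (at x)"
    using has_derivative_transform_within_open[OF assms(1) N(1) N(2)] assms(3) by blast
  from has_derivative_unique[OF this assms(2)] show ?thesis by simp
qed

lemma dg_sym: "dg u v w = dg u w v"
  by (rule derivative_unique_N[OF has_derivative_g has_derivative_g]) (rule g_sym)

lemma dg_lin1: "linear (\<lambda>u. dg u v w)"
  using has_derivative_linear[OF has_derivative_g] .

lemma dg_lin3: "linear (dg u v)"
proof (rule linearI)
  show "dg u v (a + b) = dg u v a + dg u v b" for a b
    using derivative_unique_N[OF has_derivative_g has_derivative_add[OF has_derivative_g has_derivative_g]]
      linear_add[OF g_lin(1)] by blast
  show "dg u v (c *\<^sub>R b) = c *\<^sub>R dg u v b" for c b
    using derivative_unique_N[OF has_derivative_g has_derivative_scaleR_right[OF has_derivative_g]]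
      linear_scale[OF g_lin(1)] by blast
qed

lemma dg_lin2: "linear (\<lambda>v. dg u v w)"
  using dg_lin3[of u w] by (simp add: dg_sym[of u _ w])

sublocale F: frame8 "g x" "f x"
  using g_bilinear g_sym f_frame N by unfold_locales (auto simp: spin7_frame_def)

text \<open>The Christoffel symbols with lowered index.\<close>

definition koszul :: "real^8 \<Rightarrow> real^8 \<Rightarrow> real^8 \<Rightarrow> real" where
  "koszul u v w = 1/2 * (dg u v w + dg v u w - dg w u v)"

abbreviation "\<Gamma> \<equiv> christoffel g x"

lemma christoffel_props:
  "\<Gamma> u v = \<Gamma> v u" "dg u v w = g x (\<Gamma> u v) w + g x v (\<Gamma> u w)"
proof -
  let ?P = "\<lambda>\<Gamma>. (\<forall>u v. \<Gamma> u v = \<Gamma> v u) \<and>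
     (\<forall>u v w. frechet_derivative (\<lambda>y. g y v w) (at x) u = g x (\<Gamma> u v) w + g x v (\<Gamma> u w))"
  \<comment> \<open>Existence: the Koszul expression with its last index raised by the orthonormal
    frame.\<close>
  define \<Gamma>0 where "\<Gamma>0 u v = (\<Sum>i<8. koszul u v (f x i) *\<^sub>R f x i)" for u v
  have "linear (koszul u v)" for u v
    unfolding koszul_def using linear_add[OF dg_lin3] linear_scale[OF dg_lin3]
      linear_add[OF dg_lin1] linear_scale[OF dg_lin1]
    by (intro linearI) (simp_all add: algebra_simps)
  then have k: "g x (\<Gamma>0 u v) w = koszul u v w" for u v w
    unfolding \<Gamma>0_def F.G_sum1 F.G_simps
    using F.linear_expand_real'[of "koszul u v" w] by (simp add: mult.commute)
  have "?P \<Gamma>0"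
  proof (intro conjI allI)
    show "\<Gamma>0 u v = \<Gamma>0 v u" for u v
      unfolding \<Gamma>0_def koszul_def by (simp add: dg_sym[of "f x _" u v] add.commute)
    show "frechet_derivative (\<lambda>y. g y v w) (at x) u = g x (\<Gamma>0 u v) w + g x v (\<Gamma>0 u w)" for u v w
      unfolding F.symm[of v] k dg_def[symmetric]
      by (simp add: koszul_def dg_sym[of v u w] dg_sym[of w u v] dg_sym[of u w v] field_simps)
  qed
  \<comment> \<open>Uniqueness: the two defining properties force the Koszul formula.\<close>
  moreover have "\<Gamma>' = \<Gamma>0" if "?P \<Gamma>'" for \<Gamma>'
  proof (intro ext F.G_eqI')
    fix u v w
    have s: "\<Gamma>' u v = \<Gamma>' v u" for u v by (rule conjunct1[OF that, rule_format])
    have d: "dg u v w = g x (\<Gamma>' u v) w + g x v (\<Gamma>' u w)" for u v w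
      unfolding dg_def by (rule conjunct2[OF that, rule_format])
    have "2 * koszul u v w = 2 * g x (\<Gamma>' u v) w"
      unfolding koszul_def d
      by (simp add: s[of v u] s[of w] F.symm[of "\<Gamma>' u w" v] F.symm[of "\<Gamma>' v w" u])
    then show "g x (\<Gamma>' u v) w = g x (\<Gamma>0 u v) w" by (simp add: k)
  qed
  ultimately have P: "?P \<Gamma>" unfolding christoffel_def by (rule theI[of ?P])
  show "\<Gamma> u v = \<Gamma> v u" by (rule conjunct1[OF P, rule_format])
  show "dg u v w = g x (\<Gamma> u v) w + g x v (\<Gamma> u w)"
    unfolding dg_def by (rule conjunct2[OF P, rule_format])
qed

lemma christoffel_koszul: "g x (\<Gamma> u v) w = koszul u v w"
  unfolding koszul_def christoffel_props(2)
  by (simp add: christoffel_props(1)[of v u] christoffel_props(1)[of w] F.symm[of "\<Gamma> u w" v] F.symm[of "\<Gamma> v w" u])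

lemma christoffel_linear: "linear (\<Gamma> u)"
proof (rule linearI; rule F.G_eqI')
  note l = linear_add[OF dg_lin3] linear_scale[OF dg_lin3]
    linear_add[OF dg_lin1] linear_scale[OF dg_lin1] linear_add[OF dg_lin2] linear_scale[OF dg_lin2]
  show "g x (\<Gamma> u (v + v')) w = g x (\<Gamma> u v + \<Gamma> u v') w" for v v' w
    by (simp add: F.G_simps christoffel_koszul koszul_def l algebra_simps)
  show "g x (\<Gamma> u (c *\<^sub>R v)) w = g x (c *\<^sub>R \<Gamma> u v) w" for c v w
    by (simp add: F.G_simps christoffel_koszul koszul_def l algebra_simps)
qed

abbreviation "cov_deriv \<equiv> levi_civita g x"

lemma levi_civita_linear:
  assumes "a differentiable (at x)"
  shows "linear (\<lambda>u. cov_deriv u a)"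
proof -
  have "linear (frechet_derivative a (at x))"
    using assms linear_frechet_derivative by blast
  moreover have "linear (\<lambda>u. \<Gamma> u (a x))"
    using christoffel_linear[of "a x"] by (simp add: christoffel_props(1)[of _ "a x"])
  ultimately show ?thesis
    unfolding levi_civita_def by (rule linear_compose_add)
qed

text \<open>The product rule of a metric connection. Differentiability of \<open>g\<close> is given
  for fixed arguments, so the product is first expanded in the standard basis.\<close>

lemma levi_civita_metric:
  assumes "a differentiable (at x)" "b differentiable (at x)"
  shows "((\<lambda>y. g y (a y) (b y)) has_derivative (\<lambda>u. g x (cov_deriv u a) (b x) + g x (a x) (cov_deriv u b))) (at x)"
proof -
  let ?a = "frechet_derivative a (at x)" and ?b = "frechet_derivative b (at x)"
  have a: "(a has_derivative ?a) (at x)" and b: "(b has_derivative ?b) (at x)"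
    using assms frechet_derivative_works by blast+
  have ex: "h v w = (\<Sum>p\<in>Basis. \<Sum>q\<in>Basis. (v \<bullet> p) * (w \<bullet> q) * h p q)"
    if "\<And>v. linear (h v)" "\<And>w. linear (\<lambda>v. h v w)" for h :: scalar_product and v w
  proof -
    have "h v w = (\<Sum>p\<in>Basis. (v \<bullet> p) * h p w)"
      using eq_sum_Basis[OF that(2)[of w], of v] by simp
    moreover have "h p w = (\<Sum>q\<in>Basis. (w \<bullet> q) * h p q)" for p
      using eq_sum_Basis[OF that(1)[of p], of w] by simp
    ultimately show ?thesis by (simp add: sum_distrib_left mult.assoc)
  qed
  have "((\<lambda>y. \<Sum>p\<in>Basis. \<Sum>q\<in>Basis. (a y \<bullet> p) * (b y \<bullet> q) * g y p q) has_derivative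
     (\<lambda>u. \<Sum>p\<in>Basis. \<Sum>q\<in>Basis. (?a u \<bullet> p) * (b x \<bullet> q) * g x p q
        + (a x \<bullet> p) * (?b u \<bullet> q) * g x p q + (a x \<bullet> p) * (b x \<bullet> q) * dg u p q)) (at x)"
    by (rule has_derivative_sum, rule has_derivative_sum)
      (auto intro!: derivative_eq_intros a b has_derivative_g simp: algebra_simps)
  also have "(\<lambda>u. \<Sum>p\<in>Basis. \<Sum>q\<in>Basis. (?a u \<bullet> p) * (b x \<bullet> q) * g x p q
        + (a x \<bullet> p) * (?b u \<bullet> q) * g x p q + (a x \<bullet> p) * (b x \<bullet> q) * dg u p q) =
      (\<lambda>u. g x (?a u) (b x) + g x (a x) (?b u) + dg u (a x) (b x))"
    unfolding sum.distrib ex[OF F.G_lin2 F.G_lin1, symmetric] ex[OF dg_lin3 dg_lin2, symmetric] ..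
  also have "\<dots> = (\<lambda>u. g x (cov_deriv u a) (b x) + g x (a x) (cov_deriv u b))"
    by (simp add: fun_eq_iff levi_civita_def F.G_simps christoffel_props(2))
  finally show ?thesis
  proof (rule has_derivative_transform_within_open[OF _ N])
    fix y assume "y \<in> N"
    then show "(\<Sum>p\<in>Basis. \<Sum>q\<in>Basis. (a y \<bullet> p) * (b y \<bullet> q) * g y p q) = g y (a y) (b y)"
      using ex[OF g_lin, of y "a y" "b y"] by simp
  qed
qed

section \<open>The connection form of the adapted frame and the derivative of the 4-form\<close>

definition conn :: "real^8 \<Rightarrow> real^8 \<Rightarrow> real^8" where
  "conn u v = (\<Sum>i<8. g x v (f x i) *\<^sub>R cov_deriv u (\<lambda>y. f y i))"

lemma conn_frame:
  assumes "j < 8"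
  shows "conn u (f x j) = cov_deriv u (\<lambda>y. f y j)"
proof -
  have "conn u (f x j) = (\<Sum>i<8. if i = j then cov_deriv u (\<lambda>y. f y i) else 0)"
    unfolding conn_def by (intro sum.cong) (use assms in \<open>auto simp: F.G_e\<close>)
  then show ?thesis using assms by simp
qed

lemma conn_linear: "linear (conn u)"
  unfolding conn_def
  by (rule linearI) (simp_all add: F.G_simps scaleR_left_distrib sum.distrib scaleR_sum_right)

lemma conn_linear1: "linear (\<lambda>u. conn u v)"
  unfolding conn_def
  by (intro linear_compose_sum ballI linear_compose_scale_right levi_civita_linear f_diff) simp

text \<open>Differentiate the constant functions \<open>g y (f y i) (f y j)\<close>.\<close>

lemma conn_skew: "F.skew (conn u)"
  unfolding F.skew_def
proof (intro conjI allI)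
  have fr: "g x (conn u (f x i)) (f x j) = - g x (f x i) (conn u (f x j))" if "i < 8" "j < 8" for i j
  proof -
    have "g y (f y i) (f y j) = (if i = j then 1 else 0)" if "y \<in> N" for y
      using f_frame[OF that] \<open>i < 8\<close> \<open>j < 8\<close> by (simp add: spin7_frame_def orthonormal_frame_def)
    then have "g x (cov_deriv u (\<lambda>y. f y i)) (f x j) + g x (f x i) (cov_deriv u (\<lambda>y. f y j)) = 0"
      by (rule derivative_unique_N[OF levi_civita_metric[OF f_diff[OF \<open>i < 8\<close>] f_diff[OF \<open>j < 8\<close>]] has_derivative_const])
    then show ?thesis by (simp add: conn_frame that)
  qed
  note l = linear_add[OF conn_linear] linear_scale[OF conn_linear]
  have 1: "g x (conn u (f x i)) w = - g x (f x i) (conn u w)" if "i < 8" for i w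
    by (rule F.linear_eq_on_frame[where v=w, OF F.G_lin2])
      (use fr that in \<open>auto intro!: linearI simp: l F.G_simps\<close>)
  show "g x (conn u v) w = - g x v (conn u w)" for v w
    by (rule F.linear_eq_on_frame[where v=v])
      (use 1 in \<open>auto intro!: linearI simp: l F.G_simps\<close>)
qed (rule conn_linear)

text \<open>On the frame, \<open>C u\<close> is minus the coordinate derivative of its members,
  since the Christoffel terms cancel. It measures the change of the coframe in direction
  \<open>u\<close>, see \<open>has_derivative_coframe\<close>.\<close>

definition C :: "real^8 \<Rightarrow> real^8 \<Rightarrow> real^8" where
  "C u v = \<Gamma> u v - conn u v"

lemma C_linear: "linear (C u)"
  unfolding C_def by (intro linear_compose_sub christoffel_linear conn_linear)

lemma has_derivative_coframe:
  assumes "i < 8"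
  shows "((\<lambda>y. g y (f y i) v) has_derivative (\<lambda>u. g x (f x i) (C u v))) (at x)"
proof -
  have "cov_deriv u (\<lambda>_. v) = \<Gamma> u v" for u by (simp add: levi_civita_def)
  moreover have "g x (cov_deriv u (\<lambda>y. f y i)) v = - g x (f x i) (conn u v)" for u
    using F.skewD[OF conn_skew, of u "f x i" v] by (simp add: conn_frame[OF assms])
  ultimately show ?thesis
    using levi_civita_metric[OF f_diff[OF assms], of "\<lambda>_. v"] by (simp add: C_def F.G_simps)
qed

lemma has_derivative_flat:
  assumes "i < 8"
  shows "((\<lambda>y. flat (g y) (f y i) vs) has_derivative (\<lambda>u. derivation (C u) (flat (g x) (f x i)) vs)) (at x)"
proof (cases vs rule: remdups_adj.cases)
  case (2 v)
  then show ?thesis using has_derivative_coframe[OF assms, of v] by (simp add: F.derivation_flat)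
next
  case (3 a b ws)
  then show ?thesis
    unfolding derivation_forms1_apply[OF F.flat_forms] by (simp add: flat_def)
qed (simp add: flat_def)

lemma has_derivative_coframe_wedge:
  assumes "set is \<subseteq> {..<8}"
  shows "((\<lambda>y. coframe_wedge (g y) (f y) is vs) has_derivative
    (\<lambda>u. derivation (C u) (coframe_wedge (g x) (f x) is) vs)) (at x)"
  using assms
proof (induction "is" arbitrary: vs)
  case Nil
  have "derivation (C u) (\<lambda>vs. if vs = [] then 1 else 0) vs = 0" for u
    unfolding derivation_def by (intro sum.neutral) auto
  then show ?case by simp
next
  case (Cons i "is")
  then have "i < 8" "set is \<subseteq> {..<8}" by auto
  from has_derivative_wedge[OF has_derivative_flat[OF this(1)] Cons.IH[OF this(2)]]
  show ?case by (simp add: derivation_wedge[OF F.flat_forms C_linear])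
qed

lemma \<phi>_eq: "y \<in> N \<Longrightarrow> \<phi> y = spin7_form (g y) (f y)"
  using f_frame by (simp add: spin7_frame_def)

text \<open>\<open>\<phi>\<close> has constant coefficients in the coframe, so it changes only
  through the coframe, by the Leibniz rule.\<close>

lemma has_derivative_\<phi>: "((\<lambda>y. \<phi> y vs) has_derivative (\<lambda>u. derivation (C u) (\<phi> x) vs)) (at x)"
proof -
  have "((\<lambda>y. spin7_form (g y) (f y) vs) has_derivative
      (\<lambda>u. derivation (C u) (spin7_form (g x) (f x)) vs)) (at x)"
  proof -
    have d: "derivation A (\<lambda>vs. \<alpha> vs + \<beta> vs) vs = derivation A \<alpha> vs + derivation A \<beta> vs" for A \<alpha> \<beta>
      by (simp add: derivation_def sum.distrib)
    show ?thesis
      unfolding spin7_form_def Let_def derivation_diff d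
      by (intro has_derivative_add has_derivative_diff has_derivative_coframe_wedge) auto
  qed
  then show ?thesis
    unfolding \<phi>_eq[OF N(2)]
    by (rule has_derivative_transform_within_open[OF _ N]) (simp add: \<phi>_eq)
qed

lemma frame8_adapted:
  assumes "y \<in> N" "spin7_frame (g y) (\<phi> y) e"
  shows "frame8 (g y) e"
  using g_bilinear g_sym assms by unfold_locales (auto simp: spin7_frame_def)

lemma hodge_frame: 
  assumes "y \<in> N"
  obtains e where "spin7_frame (g y) (\<phi> y) e" "hodge (g y) (\<phi> y) = frame_hodge (g y) e"
proof
  show "spin7_frame (g y) (\<phi> y) (SOME e. spin7_frame (g y) (\<phi> y) e)"
    using f_frame[OF assms] by (rule someI[where P="spin7_frame (g y) (\<phi> y)"])
qed (simp add: hodge_def)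

text \<open>The frame behind \<open>hodge\<close> is chosen separately at each point and need not
  depend continuously on it. Self-duality on \<open>N\<close> removes the star before anything is
  differentiated.\<close>

lemma hodge_\<phi>:
  assumes "y \<in> N"
  shows "hodge (g y) (\<phi> y) (\<phi> y) = \<phi> y"
proof -
  obtain e where e: "spin7_frame (g y) (\<phi> y) e" "hodge (g y) (\<phi> y) = frame_hodge (g y) e"
    using hodge_frame[OF assms] .
  interpret frame8 "g y" e using frame8_adapted[OF assms e(1)] .
  from e show ?thesis using hdg_phi by (auto simp: spin7_frame_def)
qed

lemma ext_deriv_\<phi>:
  "ext_deriv (\<lambda>y. hodge (g y) (\<phi> y) (\<phi> y)) x vs =
    (\<Sum>i<length vs. (-1) ^ i * derivation (C (vs ! i)) (\<phi> x) (take i vs @ drop (Suc i) vs))"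
proof -
  have "((\<lambda>y. hodge (g y) (\<phi> y) (\<phi> y) ws) has_derivative (\<lambda>u. derivation (C u) (\<phi> x) ws)) (at x)" for ws
    using has_derivative_\<phi> by (rule has_derivative_transform_within_open[OF _ N]) (simp add: hodge_\<phi>)
  then have "frechet_derivative (\<lambda>y. hodge (g y) (\<phi> y) (\<phi> y) ws) (at x) = (\<lambda>u. derivation (C u) (\<phi> x) ws)" for ws
    by (rule frechet_derivative_at[symmetric])
  then show ?thesis by (simp add: ext_deriv_def)
qed

section \<open>Codifferential and torsion in the frame that defines the star at
  \<open>x\<close>\<close>

context
  fixes e :: "nat \<Rightarrow> real^8"
  assumes e: "spin7_frame (g x) (\<phi> x) e" "hodge (g x) (\<phi> x) = frame_hodge (g x) e"
begin

interpretation E: frame8 "g x" e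
  using frame8_adapted[OF N(2) e(1)] .

lemma \<phi>x: "\<phi> x = E.phi"
  using e(1) by (simp add: spin7_frame_def)

text \<open>Skewness refers only to the metric, so it carries over from the frame \<open>f x\<close>
  to \<open>e\<close>.\<close>

lemma conn_skew': "E.skew (conn u)"
  using conn_skew by (simp add: F.skew_def E.skew_def)

lemma codiff_\<phi>:
  "codiff g \<phi> \<phi> x = (\<lambda>vs. \<Sum>k<8. contract (e k) (derivation (conn (e k)) E.phi) vs)"
proof
  fix vs
  have lin: "linear (\<lambda>u. derivation (C u) E.phi ws)" for ws
    using has_derivative_linear[OF has_derivative_\<phi>] by (simp add: \<phi>x)
  \<comment> \<open>\<open>\<Gamma>\<close> is symmetric and drops out of the exterior derivative by
    \<open>wedge_derivation_symmetric\<close>; only \<open>conn\<close> remains.\<close>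
  have D: "derivation (C u) E.phi = (\<lambda>ws. derivation (\<Gamma> u) E.phi ws - derivation (conn u) E.phi ws)" for u
    unfolding C_def using derivation_sub_endo[OF E.phi_forms] by auto
  have ext: "ext_deriv (\<lambda>y. hodge (g y) (\<phi> y) (\<phi> y)) x =
      (\<lambda>vs. - (\<Sum>k<8. wedge (flat (g x) (e k)) (derivation (conn (e k)) E.phi) vs))"
  proof
    fix vs
    have "(\<Sum>k<8. wedge (flat (g x) (e k)) (derivation (C (e k)) E.phi) vs) =
        (\<Sum>i<length vs. \<Sum>k<8. (-1) ^ i * g x (e k) (vs ! i) * derivation (C (e k)) E.phi (take i vs @ drop (Suc i) vs))"
      unfolding wedge1_expand[OF E.flat_forms] by (subst sum.swap) simp
    also have "\<dots> = ext_deriv (\<lambda>y. hodge (g y) (\<phi> y) (\<phi> y)) x vs"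
      unfolding ext_deriv_\<phi> \<phi>x
    proof (intro sum.cong refl)
      fix i
      show "(\<Sum>k<8. (-1) ^ i * g x (e k) (vs ! i) * derivation (C (e k)) E.phi (take i vs @ drop (Suc i) vs)) =
        (-1) ^ i * derivation (C (vs ! i)) E.phi (take i vs @ drop (Suc i) vs)"
        using E.linear_expand_real'[OF lin] by (simp add: mult.assoc flip: sum_distrib_left)
    qed
    finally show "ext_deriv (\<lambda>y. hodge (g y) (\<phi> y) (\<phi> y)) x vs =
        - (\<Sum>k<8. wedge (flat (g x) (e k)) (derivation (conn (e k)) E.phi) vs)"
      using E.wedge_derivation_symmetric[OF christoffel_props(1) christoffel_linear E.phi_forms]
      by (simp add: D wedge_linear sum_subtractf)
  qed
  \<comment> \<open>The sign in the codifferential cancels the one in \<open>ext\<close>. Then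
    \<open>hdg_wedge\<close> turns each coframe factor into a contraction, and the star disappears
    by \<open>hdg_derivation_phi\<close>.\<close>
  have "codiff g \<phi> \<phi> x vs = (\<Sum>k<8. E.hdg (wedge (flat (g x) (e k)) (derivation (conn (e k)) E.phi)) vs)"
    unfolding codiff_def ext e(2) by (simp add: E.hdg_linear)
  also have "\<dots> = (\<Sum>k<8. contract (e k) (derivation (conn (e k)) E.phi) vs)"
    using E.hdg_wedge[OF E.derivation_forms[OF E.phi_forms conn_linear]] E.hdg_derivation_phi[OF conn_skew']
    by (simp add: contract_apply)
  finally show "codiff g \<phi> \<phi> x vs = \<dots>" .
qed

lemma conn_expand: "(\<lambda>v. \<Sum>k<8. g x u (e k) *\<^sub>R conn (e k) v) = conn u"
  by (rule ext) (rule E.linear_expand[OF conn_linear1, symmetric])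

lemma hodge_x: "hodge (g x) E.phi = E.hdg"
  using e(2) unfolding \<phi>x .

lemma proj7_eq: "proj7 (g x) (\<phi> x) \<omega> = E.frame_proj7 \<omega>"
  by (simp add: proj7_def hodge_x \<phi>x fun_eq_iff)

text \<open>The assumption makes \<open>f\<close> the frame that \<open>minimal_connection\<close>
  chooses. Projections are taken in the frame \<open>e\<close> of the star, expansions in
  \<open>f x\<close>.\<close>

lemma torsion_eq:
  assumes "f = (SOME e. \<exists>N. open N \<and> x \<in> N \<and> local_spin7_frame N g \<phi> e)"
  shows "intrinsic_torsion g \<phi> x u v = - E.part7 (conn u) v"
proof -
  let ?\<omega> = "proj21 (g x) (\<phi> x) (connection_form g f x u)"
  have cf: "connection_form g f x u = endo_form (g x) (conn u)"
    by (simp add: connection_form_def conn_def[abs_def])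
  have \<omega>: "?\<omega> [a, b] = g x (conn u a - E.part7 (conn u) a) b" for a b
    unfolding proj21_def cf proj7_eq E.frame_proj7_endo_form[OF conn_skew'] by (simp add: F.G_simps)
  have fd: "frechet_derivative (\<lambda>y. g y v (f y i)) (at x) u = g x (C u v) (f x i)" if "i < 8" for i
  proof -
    have "((\<lambda>y. g y v (f y i)) has_derivative (\<lambda>u. g x (f x i) (C u v))) (at x)"
      using has_derivative_coframe[OF that]
      by (rule has_derivative_transform_within_open[OF _ N]) (rule g_sym)
    from fun_cong[OF frechet_derivative_at[OF this], of u] show ?thesis
      using F.symm[of "f x i" "C u v"] by simp
  qed
  have pl: "linear (\<lambda>a. conn u a - E.part7 (conn u) a)"
    by (rule linearI) (simp_all add: linear_add[OF conn_linear] linear_scale[OF conn_linear] E.part7_lin algebra_simps)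
  have "minimal_connection g \<phi> x u (\<lambda>_. v) =
      (\<Sum>i<8. g x (C u v) (f x i) *\<^sub>R f x i + g x v (f x i) *\<^sub>R (\<Sum>j<8. ?\<omega> [f x i, f x j] *\<^sub>R f x j))"
    unfolding minimal_connection_def Let_def assms[symmetric] by (intro sum.cong refl) (simp add: fd)
  \<comment> \<open>The derivatives of the components give \<open>C\<close>, the spin(7)-part of the
    connection form gives \<open>conn - part7\<close>. Subtracting
    \<open>\<Gamma> = C + conn\<close> leaves \<open>- part7\<close>.\<close>
  also have "\<dots> = C u v + (conn u v - E.part7 (conn u) v)"
    unfolding \<omega> F.expand[symmetric] sum.distrib F.linear_expand[OF pl, symmetric] ..
  finally show ?thesis
    by (simp add: intrinsic_torsion_def levi_civita_def C_def)
qed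

lemma torsion_formulas:
  assumes "f = (SOME e. \<exists>N. open N \<and> x \<in> N \<and> local_spin7_frame N g \<phi> e)"
  shows "endo_form (g x) (intrinsic_torsion g \<phi> x X) =
      (\<lambda>vs. - (1/2) * proj7 (g x) (\<phi> x) (contract X (codiff g \<phi> \<phi> x)) vs
            + 7/4 * proj7 (g x) (\<phi> x) (wedge (flat (g x) X) (lee_form g \<phi> x)) vs)" (is ?A)
    and "endo_form (g x) (intrinsic_torsion g \<phi> x X) =
      (\<lambda>vs. - (1/2) * proj7 (g x) (\<phi> x) (contract X (proj48 (g x) (\<phi> x) (codiff g \<phi> \<phi> x))) vs
            + 1/4 * proj7 (g x) (\<phi> x) (wedge (flat (g x) X) (lee_form g \<phi> x)) vs)" (is ?B)
proof -
  let ?b = "\<lambda>k. conn (e k)"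
  let ?T = "E.lee_vec ?b"
  note cd = codiff_\<phi>
  have T: "E.hdg (wedge (codiff g \<phi> \<phi> x) E.phi) = flat (g x) (7 *\<^sub>R ?T)"
    unfolding cd by (rule E.hdg_wedge_\<delta>[OF conn_skew'])
  have lee: "lee_form g \<phi> x = flat (g x) ?T"
    unfolding lee_form_def \<phi>x hodge_x T by (auto simp: flat_def F.G_simps split: list.split)
  have p48: "proj48 (g x) (\<phi> x) (codiff g \<phi> \<phi> x) = (\<lambda>vs. codiff g \<phi> \<phi> x vs + contract ?T E.phi vs)"
    unfolding \<phi>x
  proof (rule E.proj48_eq[OF _ _ T])
    show "hodge (g x) E.phi = E.hdg" by (rule hodge_x)
    show "codiff g \<phi> \<phi> x \<in> forms 3" unfolding cd by (rule E.\<delta>_forms[OF conn_skew'])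
  qed
  have \<xi>: "intrinsic_torsion g \<phi> x X = (\<lambda>v. - E.part7 (conn X) v)"
    using torsion_eq[OF assms] by auto
  show ?A
    using E.torsion_formula_1[of ?b X, OF conn_skew']
    unfolding \<xi> proj7_eq lee cd conn_expand .
  show ?B
    using E.torsion_formula_2[of ?b X, OF conn_skew']
    unfolding \<xi> proj7_eq lee p48 unfolding cd conn_expand .
qed

end

end

section \<open>The two formulas in every chart\<close>

theorem proposition2p2:
  fixes M :: "'a topology" and \<A> :: "'a chart set"
    and g :: "'a chart \<Rightarrow> real^8 \<Rightarrow> scalar_product" and \<Phi> :: "'a chart \<Rightarrow> real^8 \<Rightarrow> form"
    and X :: "'a vector_field"
  assumes "smooth_manifold8 M \<A>" and "riemannian_metric \<A> g" and "spin7_structure \<A> g \<Phi>"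
    and "vector_field \<A> X"
  shows "\<forall>c\<in>\<A>. \<forall>x\<in>chart_image c.
    endo_form (g c x) (intrinsic_torsion (g c) (\<Phi> c) x (X c x)) =
      (\<lambda>vs. - (1/2) * proj7 (g c x) (\<Phi> c x)
                       (contract (X c x) (codiff (g c) (\<Phi> c) (\<Phi> c) x)) vs
            + 7/4 * proj7 (g c x) (\<Phi> c x)
                       (wedge (flat (g c x) (X c x)) (lee_form (g c) (\<Phi> c) x)) vs)
    \<and>
    endo_form (g c x) (intrinsic_torsion (g c) (\<Phi> c) x (X c x)) =
      (\<lambda>vs. - (1/2) * proj7 (g c x) (\<Phi> c x)
                       (contract (X c x)
                         (proj48 (g c x) (\<Phi> c x) (codiff (g c) (\<Phi> c) (\<Phi> c) x))) vs
            + 1/4 * proj7 (g c x) (\<Phi> c x)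
                       (wedge (flat (g c x) (X c x)) (lee_form (g c) (\<Phi> c) x)) vs)"
proof (intro ballI)
  fix c x assume c: "c \<in> \<A>" and x: "x \<in> chart_image c"
  \<comment> \<open>The very choice made in \<open>minimal_connection\<close>, as
    \<open>torsion_formulas\<close> demands.\<close>
  define f where "f = (SOME e. \<exists>N. open N \<and> x \<in> N \<and> local_spin7_frame N (g c) (\<Phi> c) e)"
  have "\<exists>e N. open N \<and> x \<in> N \<and> local_spin7_frame N (g c) (\<Phi> c) e"
    using assms(3) c x unfolding spin7_structure_def by blast
  then have "\<exists>N. open N \<and> x \<in> N \<and> local_spin7_frame N (g c) (\<Phi> c) f"
    unfolding f_def by (rule someI_ex)
  then obtain N where nbhd: "open N" "x \<in> N" "local_spin7_frame N (g c) (\<Phi> c) f" by blast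
  have op: "open (chart_image c)"
    using assms(1) c by (simp add: smooth_manifold8_def)
  have met: "bilinear (g c y) \<and> (\<forall>u v. g c y u v = g c y v u)" if "y \<in> chart_image c" for y
    using assms(2) c that unfolding riemannian_metric_def by blast
  have sm: "smooth_on (chart_image c) (\<lambda>y. g c y u v)" for u v
    using assms(2) c unfolding riemannian_metric_def by blast
  \<comment> \<open>The neighbourhood of the chosen frame may leave the chart image, outside which
    nothing is known about \<open>g c\<close>; hence the intersection.\<close>
  interpret spin7_chart "g c" "\<Phi> c" "N \<inter> chart_image c" x f
  proof
    show "open (N \<inter> chart_image c)" "x \<in> N \<inter> chart_image c" using nbhd op x by auto
    show "(\<lambda>y. g c y u v) differentiable (at x)" for u v
      using smooth_on_differentiable[OF sm x] .
    show "(\<lambda>y. f y i) differentiable (at x)" if "i < 8" for i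
      using nbhd(2,3) that smooth_on_differentiable unfolding local_spin7_frame_def by blast
  qed (use met nbhd(3) in \<open>auto simp: local_spin7_frame_def\<close>)
  obtain e where e: "spin7_frame (g c x) (\<Phi> c x) e" "hodge (g c x) (\<Phi> c x) = frame_hodge (g c x) e"
    by (rule hodge_frame[of x]) (use nbhd(2) x in auto)
  show "endo_form (g c x) (intrinsic_torsion (g c) (\<Phi> c) x (X c x)) =
      (\<lambda>vs. - (1/2) * proj7 (g c x) (\<Phi> c x)
                       (contract (X c x) (codiff (g c) (\<Phi> c) (\<Phi> c) x)) vs
            + 7/4 * proj7 (g c x) (\<Phi> c x)
                       (wedge (flat (g c x) (X c x)) (lee_form (g c) (\<Phi> c) x)) vs)
    \<and>
    endo_form (g c x) (intrinsic_torsion (g c) (\<Phi> c) x (X c x)) =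
      (\<lambda>vs. - (1/2) * proj7 (g c x) (\<Phi> c x)
                       (contract (X c x)
                         (proj48 (g c x) (\<Phi> c x) (codiff (g c) (\<Phi> c) (\<Phi> c) x))) vs
            + 1/4 * proj7 (g c x) (\<Phi> c x)
                       (wedge (flat (g c x) (X c x)) (lee_form (g c) (\<Phi> c) x)) vs)"
    using torsion_formulas[OF e f_def] ..
qed

end
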